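(* Regard two permutations as equivalent if they are Knuth-equivalent, and let $\mathbf p$ be the bivincular pattern $(231,\varnothing,\{0\})$. Then $\widetilde{\mathfrak A}_n(\mathbf p)$ consists of the permutations in $\mathfrak S_n$ whose insertion tableau is hook-shaped with $2$ in the first row, as well as the reverse identity $\mathrm{id}^{\mathrm r}=n(n-1)\cdots 21$. The cardinalities are $$|\widetilde{\mathfrak A}_n(\mathbf p)| = 1,\,2,\,4,\,11,\,36,\,127,\,463,\,1717,\,6436,\dots\qquad (n=1,2,3,\dots,9),$$ which is, from $n=3$, the sequence A112849 of the Online Encyclopedia of Integer Sequences: the number of congruence classes (epimorphisms/vertex partitionings induced by graph endomorphisms) of undirected cycles of even length, $|\mathcal C(C_{2m})|$.
   Context: $\mathfrak S_n$ is the set of permutations of $\{1,\dots,n\}$, written in one-line notation. An elementary Knuth-transformation on a permutation applies to three consecutive letters one of the replacements $yzx\mapsto yxz$ if $x<y\le z$, or $xzy\mapsto zxy$ if $x\le y<z$, or one of their inverses. Two permutations are Knuth-equivalent if one can be changed into the other by a sequence of elementary Knuth-transformations; equivalently, they have the same insertion tableau under Robinson–Schensted row insertion. A tableau is hook-shaped if its shape is $(k,1,1,\dots,1)$. An occurrence of the bivincular pattern $(231,\varnothing,\{0\})$ in $\pi=\pi_1\cdots\pi_n\in\mathfrak S_n$ is a subsequence $\pi_{i_1}\pi_{i_2}\pi_{i_3}$ ($i_1<i_2<i_3$) in the same relative order as $231$ whose smallest letter is the value $1$ (so $\pi_{i_3}=1$ and $\pi_{i_1}<\pi_{i_2}$).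 A permutation avoids the pattern if it has no occurrence of it. $\widetilde{\mathfrak A}_n(\mathbf p)$ is the set of $\pi\in\mathfrak S_n$ such that $\pi$ and every permutation equivalent to $\pi$ avoids $\mathbf p$. $C_{2m}$ is the undirected cycle on $2m$ vertices. A graph endomorphism is a map from the vertex set to itself sending edges to edges; the congruence (vertex partitioning) it induces is the partition of the vertex set into its nonempty fibres, and $\mathcal C(C_{2m})$ is the set of such partitions. The index $m$ belongs to the description of the graph sequence and is not claimed to equal $n$. *)

theory Defs
  imports "HOL-Combinatorics.Multiset_Permutations"
begin

section \<open>Knuth equivalence and Schensted insertion\<close>

text \<open>Permutations of \<open>{1..n}\<close> in one-line notation are the elements of
  \<^term>\<open>permutations_of_set {1..n::nat}\<close>.\<close>

inductive knuth_step :: "'a::linorder list \<Rightarrow> 'a list \<Rightarrow> bool" where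
  "x < y \<Longrightarrow> y \<le> z \<Longrightarrow> knuth_step (us @ [y, z, x] @ vs) (us @ [y, x, z] @ vs)"
| "x \<le> y \<Longrightarrow> y < z \<Longrightarrow> knuth_step (us @ [x, z, y] @ vs) (us @ [z, x, y] @ vs)"

definition knuth_equiv :: "'a::linorder list \<Rightarrow> 'a list \<Rightarrow> bool" where
  "knuth_equiv = equivclp knuth_step"

text \<open>Tableaux are lists of rows. Inserting a letter into a row returns the new row and the
  letter that is bumped out of it, if any.\<close>

fun row_insert :: "'a::linorder \<Rightarrow> 'a list \<Rightarrow> 'a list \<times> 'a option" where
  "row_insert x [] = ([x], None)"
| "row_insert x (y # ys) =
    (if x < y then (x # ys, Some y)
     else (case row_insert x ys of (r, b) \<Rightarrow> (y # r, b)))"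

fun tableau_insert :: "'a::linorder \<Rightarrow> 'a list list \<Rightarrow> 'a list list" where
  "tableau_insert x [] = [[x]]"
| "tableau_insert x (r # rs) =
    (case row_insert x r of
       (r', None) \<Rightarrow> r' # rs
     | (r', Some y) \<Rightarrow> r' # tableau_insert y rs)"

definition insertion_tableau :: "'a::linorder list \<Rightarrow> 'a list list" where
  "insertion_tableau w = fold tableau_insert w []"

definition hook_shaped :: "'a list list \<Rightarrow> bool" where
  "hook_shaped T \<longleftrightarrow> (\<exists>k j. k \<ge> 1 \<and> map length T = k # replicate j 1)"

section \<open>Bivincular patterns\<close>

text \<open>A bivincular pattern \<open>(\<sigma>, X, Y)\<close>: \<open>\<sigma>\<close> is a permutation of \<open>{1..k}\<close> and \<open>X, Y \<subseteq> {0..k}\<close>.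
  An occurrence is given by its list \<open>is\<close> of (1-based) positions. With the positions
  \<open>i\<^sub>1 < \<dots> < i\<^sub>k\<close>, the letters in increasing order \<open>j\<^sub>1 < \<dots> < j\<^sub>k\<close>, and the conventions
  \<open>i\<^sub>0 = j\<^sub>0 = 0\<close> and \<open>i\<^bsub>k+1\<^esub> = j\<^bsub>k+1\<^esub> = n + 1\<close>, it is required that \<open>i\<^bsub>x+1\<^esub> = i\<^sub>x + 1\<close> for \<open>x \<in> X\<close>
  and \<open>j\<^bsub>y+1\<^esub> = j\<^sub>y + 1\<close> for \<open>y \<in> Y\<close>.\<close>

type_synonym bivincular_pattern = "nat list \<times> nat set \<times> nat set"

definition bivincular_occurrence :: "bivincular_pattern \<Rightarrow> nat list \<Rightarrow> nat list \<Rightarrow> bool" where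
  "bivincular_occurrence p \<pi> is =
    (case p of (\<sigma>, X, Y) \<Rightarrow>
      let n = length \<pi>;
          letters = map (\<lambda>i. \<pi> ! (i - 1)) is;
          I = 0 # is @ [n + 1];
          J = 0 # sort letters @ [n + 1]
      in length is = length \<sigma> \<and> sorted_wrt (<) is \<and> set is \<subseteq> {1..n} \<and>
         (\<forall>a<length \<sigma>. \<forall>b<length \<sigma>. letters ! a < letters ! b \<longleftrightarrow> \<sigma> ! a < \<sigma> ! b) \<and>
         (\<forall>x\<in>X. I ! (x + 1) = I ! x + 1) \<and>
         (\<forall>y\<in>Y. J ! (y + 1) = J ! y + 1))"

definition avoids :: "nat list \<Rightarrow> bivincular_pattern \<Rightarrow> bool" where
  "avoids \<pi> p \<longleftrightarrow> \<not> (\<exists>is. bivincular_occurrence p \<pi> is)"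

definition pattern_231_min :: bivincular_pattern where
  "pattern_231_min = ([2, 3, 1], {}, {0})"

text \<open>An occurrence of \<open>(231, \<emptyset>, {0})\<close> is a pair of increasing letters to the left of the letter \<open>1\<close>:\<close>

lemma avoids_pattern_231_min_iff:
  "avoids \<pi> pattern_231_min \<longleftrightarrow>
    \<not> (\<exists>a b c. a < b \<and> b < c \<and> c < length \<pi> \<and> \<pi> ! c = 1 \<and> 1 < \<pi> ! a \<and> \<pi> ! a < \<pi> ! b)"
proof -
  have occ: "bivincular_occurrence pattern_231_min \<pi> is \<longleftrightarrow>
    (\<exists>i j k. is = [i, j, k] \<and> 1 \<le> i \<and> i < j \<and> j < k \<and> k \<le> length \<pi> \<and>
       \<pi> ! (k - 1) = 1 \<and> 1 < \<pi> ! (i - 1) \<and> \<pi> ! (i - 1) < \<pi> ! (j - 1))" for "is"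
  proof (cases "length is = 3")
    case True
    then obtain i j k where "is = [i, j, k]"
      by (auto simp: length_Suc_conv numeral_3_eq_3)
    then show ?thesis
      by (auto simp: bivincular_occurrence_def pattern_231_min_def Let_def numeral_3_eq_3
          less_Suc_eq all_conj_distrib)
  next
    case False
    then show ?thesis
      by (auto simp: bivincular_occurrence_def pattern_231_min_def Let_def)
  qed
  show ?thesis
  proof -
    have "(\<exists>is. bivincular_occurrence pattern_231_min \<pi> is) \<longleftrightarrow>
      (\<exists>i j k. 1 \<le> i \<and> i < j \<and> j < k \<and> k \<le> length \<pi> \<and>
       \<pi> ! (k - 1) = 1 \<and> 1 < \<pi> ! (i - 1) \<and> \<pi> ! (i - 1) < \<pi> ! (j - 1))" (is "_ \<longleftrightarrow> ?R")
      unfolding occ by blast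
    also have "?R \<longleftrightarrow>
      (\<exists>a b c. a < b \<and> b < c \<and> c < length \<pi> \<and> \<pi> ! c = 1 \<and> 1 < \<pi> ! a \<and> \<pi> ! a < \<pi> ! b)" (is "_ \<longleftrightarrow> ?S")
    proof
      assume ?R
      then obtain i j k where "1 \<le> i" "i < j" "j < k" "k \<le> length \<pi>" "\<pi> ! (k - 1) = 1"
        "1 < \<pi> ! (i - 1)" "\<pi> ! (i - 1) < \<pi> ! (j - 1)" by blast
      then show ?S
        by (intro exI[of _ "i - 1"] exI[of _ "j - 1"] exI[of _ "k - 1"]) auto
    next
      assume ?S
      then obtain a b c where "a < b" "b < c" "c < length \<pi>" "\<pi> ! c = 1"
        "1 < \<pi> ! a" "\<pi> ! a < \<pi> ! b" by blast
      then show ?R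
        by (intro exI[of _ "Suc a"] exI[of _ "Suc b"] exI[of _ "Suc c"]) auto
    qed
    finally show ?thesis
      unfolding avoids_def by simp
  qed
qed

definition class_avoiders ::
    "(nat list \<Rightarrow> nat list \<Rightarrow> bool) \<Rightarrow> bivincular_pattern \<Rightarrow> nat \<Rightarrow> nat list set" where
  "class_avoiders R p n =
    {\<pi> \<in> permutations_of_set {1..n}.
       avoids \<pi> p \<and> (\<forall>\<tau>\<in>permutations_of_set {1..n}. R \<pi> \<tau> \<longrightarrow> avoids \<tau> p)}"

section \<open>Congruences of graphs\<close>

text \<open>A graph is a pair of its vertex set and its set of edges, the latter being unordered pairs.\<close>

definition cycle_graph :: "nat \<Rightarrow> nat set \<times> nat set set" where
  "cycle_graph k = ({0..<k}, {{i, (i + 1) mod k} | i. i < k})"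

definition graph_endomorphisms :: "'a set \<times> 'a set set \<Rightarrow> ('a \<Rightarrow> 'a) set" where
  "graph_endomorphisms G = {f. f ` fst G \<subseteq> fst G \<and> (\<forall>e\<in>snd G. f ` e \<in> snd G)}"

definition fibre_partition :: "'a set \<Rightarrow> ('a \<Rightarrow> 'b) \<Rightarrow> 'a set set" where
  "fibre_partition V f = (\<lambda>y. {x \<in> V. f x = y}) ` (f ` V)"

definition graph_congruences :: "'a set \<times> 'a set set \<Rightarrow> 'a set set set" where
  "graph_congruences G = fibre_partition (fst G) ` graph_endomorphisms G"

end

(* The reading word of the insertion tableau P(w) is Knuth-equivalent to w, and equivalent words
   have the same P. If P is not a hook, a row below the first contains an ascent, which stands
   before the 1 in the reading word. If P is a hook with first row 1 < a < ... and 2 below the 1,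
   the reading word contains 2 1 a, which is equivalent to 2 a 1. Conversely, if an ascent
   precedes the 1 in w, then the 1 bumps a letter into the second row, and from then on 2 can
   enter the first row only by bumping a second letter into the second row.
   Undoing the last insertion shows that a hook with leg length j on n letters belongs to
   (n-1 choose j) words; summing over the (n-2 choose j) legs inside {3..n} gives
   (2n-3 choose n-1) by Vandermonde, and the reverse identity contributes one more.
   An endomorphism of the cycle with 2m vertices is a closed walk of 2m steps +1 or -1: it is
   either bijective, or has m steps of each kind. The latter lifts to the integers with values in an
   interval too short to wrap around, and its fibres determine the steps up to a global sign. *)

theory Submission
  imports Defs
begin

subsection \<open>Knuth equivalence\<close>

text \<open>The elementary moves stripped of their context. The letters that such a triple bumps out
  of a row may again form one, so this is the relation to carry from row to row.\<close>

inductive knuth_triple :: "'a::linorder list \<Rightarrow> 'a list \<Rightarrow> bool" where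
  "x < y \<Longrightarrow> y \<le> z \<Longrightarrow> knuth_triple [y, z, x] [y, x, z]"
| "x \<le> y \<Longrightarrow> y < z \<Longrightarrow> knuth_triple [x, z, y] [z, x, y]"

lemma knuth_step_iff:
  "knuth_step w w' \<longleftrightarrow>
    (\<exists>us u v vs. knuth_triple u v \<and> w = us @ u @ vs \<and> w' = us @ v @ vs)"
  (is "?L \<longleftrightarrow> ?R")
proof
  show "?L \<Longrightarrow> ?R" by (elim knuth_step.cases) (blast intro: knuth_triple.intros)+
  show "?R \<Longrightarrow> ?L" by (elim exE conjE knuth_triple.cases) (simp_all only: knuth_step.intros)
qed

lemma knuth_equiv_refl [simp]: "knuth_equiv w w"
  by (simp add: knuth_equiv_def)

lemma knuth_equiv_sym: "knuth_equiv u v \<Longrightarrow> knuth_equiv v u"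
  unfolding knuth_equiv_def by (rule equivclp_sym)

lemma knuth_equiv_trans [trans]: "knuth_equiv u v \<Longrightarrow> knuth_equiv v w \<Longrightarrow> knuth_equiv u w"
  unfolding knuth_equiv_def by (rule equivclp_trans)

lemma knuth_step_equiv: "knuth_step u v \<Longrightarrow> knuth_equiv u v"
  unfolding knuth_equiv_def by (rule r_into_equivclp)

lemma knuth_equiv_invariant:
  assumes "knuth_equiv u v" "\<And>u v. knuth_step u v \<Longrightarrow> f u = f v"
  shows "f u = f v"
  using assms(1) unfolding knuth_equiv_def
  by (induction rule: equivclp_induct) (auto dest: assms(2))

lemma knuth_step_context:
  "knuth_step u v \<Longrightarrow> knuth_step (us @ u @ vs) (us @ v @ vs)"
  unfolding knuth_step_iff by (metis append.assoc)

lemma knuth_equiv_context: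
  assumes "w = us @ u @ vs" "w' = us @ v @ vs" "knuth_equiv u v"
  shows "knuth_equiv w w'"
  using assms(3) unfolding assms(1,2) knuth_equiv_def
  by (induction rule: equivclp_induct)
    (auto intro: equivclp_into_equivclp knuth_step_context)

lemma knuth_equiv_mset:
  assumes "knuth_equiv u v"
  shows "mset u = mset v"
  by (rule knuth_equiv_invariant[OF assms]) (auto simp: knuth_step.simps)

subsection \<open>Row insertion\<close>

lemma row_insert_NoneD: "row_insert x r = (r', None) \<Longrightarrow> r' = r @ [x]"
  by (induction r arbitrary: r') (auto split: if_splits prod.splits)

lemma row_insert_SomeD:
  "row_insert x r = (r', Some y) \<Longrightarrow>
    x < y \<and> (\<exists>a b. r = a @ y # b \<and> r' = a @ x # b \<and> (\<forall>z\<in>set a. z \<le> x))"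
proof (induction r arbitrary: r')
  case (Cons h t)
  show ?case
  proof (cases "x < h")
    case True
    with Cons.prems show ?thesis by (intro conjI exI[of _ "[]"] exI[of _ t]) auto
  next
    case False
    with Cons.prems obtain t' where t: "row_insert x t = (t', Some y)" "r' = h # t'"
      by (auto split: prod.splits)
    from Cons.IH[OF t(1)] obtain a b where "x < y" "t = a @ y # b" "t' = a @ x # b"
      "\<forall>z\<in>set a. z \<le> x" by blast
    with t False show ?thesis
      by (intro conjI exI[of _ "h # a"] exI[of _ b]) auto
  qed
qed auto

lemma row_insert_None_iff:
  "snd (row_insert x r) = None \<longleftrightarrow> (\<forall>z\<in>set r. z \<le> x)"
  by (induction r) (auto split: prod.splits)

lemma row_insert_append:
  "\<forall>z\<in>set r. z \<le> x \<Longrightarrow> row_insert x r = (r @ [x], None)"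
  by (induction r) auto

lemma row_insert_bump:
  "\<forall>z\<in>set a. z \<le> x \<Longrightarrow> x < y \<Longrightarrow> row_insert x (a @ y # b) = (a @ x # b, Some y)"
  by (induction a) auto

lemma sorted_row_insert: "sorted r \<Longrightarrow> sorted (fst (row_insert x r))"
proof -
  assume r: "sorted r"
  obtain r' b where rb: "row_insert x r = (r', b)" by fastforce
  show ?thesis
  proof (cases b)
    case None
    with rb have "r' = r @ [x]" "\<forall>z\<in>set r. z \<le> x"
      using row_insert_NoneD row_insert_None_iff[of x r] by auto
    with r rb show ?thesis by (simp add: sorted_append)
  next
    case (Some y)
    with rb row_insert_SomeD[of x r r' y] obtain a b where
      "x < y" "r = a @ y # b" "r' = a @ x # b" "\<forall>z\<in>set a. z \<le> x" by blast
    with r rb show ?thesis by (force simp: sorted_append)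
  qed
qed

text \<open>The bumped letter is the leftmost one above \<open>x\<close>, hence in a sorted row the
  least such letter.\<close>

lemma row_insert_bumps_le:
  assumes "sorted r" "row_insert x r = (r', Some y)" "z \<in> set r" "x < z"
  shows "y \<le> z"
proof -
  from row_insert_SomeD[OF assms(2)] obtain a b where
    "r = a @ y # b" "\<forall>z\<in>set a. z \<le> x" by blast
  with assms(1,3,4) show ?thesis by (auto simp: sorted_append)
qed

section \<open>Invariance of the insertion tableau under Knuth moves\<close>

text \<open>The second component lists the bumped letters in the order of bumping. Lower rows depend
  on the inserted word only through this list, so insertion into a tableau can be analysed one row
  at a time.\<close>

fun row_insert_word :: "'a::linorder list \<Rightarrow> 'a list \<Rightarrow> 'a list \<times> 'a list" where
  "row_insert_word [] r = (r, [])"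
| "row_insert_word (x # w) r =
    (case row_insert x r of (r', b) \<Rightarrow>
     case row_insert_word w r' of (r'', v) \<Rightarrow>
       (r'', case b of None \<Rightarrow> v | Some y \<Rightarrow> y # v))"

lemma fold_tableau_insert_Cons:
  "fold tableau_insert w (r # rs) =
    fst (row_insert_word w r) # fold tableau_insert (snd (row_insert_word w r)) rs"
  by (induction w arbitrary: r rs) (auto split: prod.splits option.splits)

lemma row_insert_word_pass:
  "\<forall>z\<in>set w. h \<le> z \<Longrightarrow>
    row_insert_word w (h # t) = (h # fst (row_insert_word w t), snd (row_insert_word w t))"
  by (induction w arbitrary: t) (auto split: prod.splits option.splits)

text \<open>Induction along the row: while no letter is below the head \<open>h\<close>, the head is
  passed and nothing changes. Otherwise the least letter \<open>x\<close> is below \<open>h\<close>,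
  and it remains to compare the largest of the first two inserted letters, or the pivot
  \<open>y\<close>, with \<open>h\<close>; each case yields equal bumped words or a new triple
  involving \<open>h\<close>.\<close>

lemma row_insert_word_knuth_triple:
  assumes "sorted r" "knuth_triple u v"
  shows "fst (row_insert_word u r) = fst (row_insert_word v r) \<and>
    (snd (row_insert_word u r) = snd (row_insert_word v r) \<or>
     knuth_triple (snd (row_insert_word u r)) (snd (row_insert_word v r)))"
  using assms
proof (induction r)
  case Nil
  then show ?case by (auto elim!: knuth_triple.cases)
next
  case (Cons h t)
  from Cons.prems have t: "sorted t" "\<And>z. z \<in> set t \<Longrightarrow> h \<le> z" by auto
  note IH = Cons.IH[OF t(1) \<open>knuth_triple u v\<close>]
  show ?case
  proof (cases "\<exists>z\<in>set u. z < h")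
    case False
    moreover have "set u = set v" using \<open>knuth_triple u v\<close> by cases auto
    ultimately show ?thesis using IH by (simp add: row_insert_word_pass not_less)
  next
    case True
    from \<open>knuth_triple u v\<close> show ?thesis
    proof cases
      case (1 x y z)
      with True have "x < h" by auto
      obtain t1 b1 where t1: "row_insert z t = (t1, b1)" by fastforce
      show ?thesis
      proof (cases "y < h")
        case True
        have "knuth_triple [h, c, y] [h, y, c]" if "b1 = Some c" for c
        proof (rule knuth_triple.intros)
          show "y < h" by fact
          from row_insert_SomeD[of z t t1 c] t1 that have "c \<in> set t" by auto
          then show "h \<le> c" by (rule t(2))
        qed
        with 1 t1 True \<open>x < h\<close> show ?thesis by (cases b1) auto
      next
        case False
        obtain t2 b2 where t2: "row_insert y t = (t2, b2)" by fastforce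
        obtain t3 b3 where t3: "row_insert z t2 = (t3, b3)" by fastforce
        have "knuth_triple [c, d, h] [c, h, d]" if "b2 = Some c" "b3 = Some d" for c d
        proof (rule knuth_triple.intros)
          from row_insert_SomeD[of y t t2 c] t2 that obtain a b where
            ab: "y < c" "t = a @ c # b" "t2 = a @ y # b" "\<forall>z\<in>set a. z \<le> y" by blast
          with False show "h < c" by auto
          from row_insert_SomeD[of z t2 t3 d] t3 that have d: "z < d" "d \<in> set t2" by auto
          \<comment> \<open>Since \<open>z\<close> is at least \<open>y\<close>, it passes
            \<open>a\<close> and the new entry \<open>y\<close>, so \<open>d\<close> lies to the
            right of the place where \<open>c\<close> was bumped.\<close>
          with ab \<open>y \<le> z\<close> have "d \<in> set b" by force
          with ab t show "c \<le> d" by (auto simp: sorted_append)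
        qed
        moreover have "b3 = None" if "b2 = None"
        proof -
          have "\<forall>w\<in>set t. w \<le> y" "t2 = t @ [y]"
            using t2 that row_insert_None_iff[of y t] row_insert_NoneD by auto
          then show ?thesis using row_insert_None_iff[of z t2] t3 \<open>y \<le> z\<close> by auto
        qed
        ultimately show ?thesis using 1 False \<open>x < h\<close> t2 t3
          by (auto split: option.splits)
      qed
    next
      case (2 x y z)
      with True have "x < h" by auto
      show ?thesis
      proof (cases "z < h")
        case True
        show ?thesis
        proof (cases t)
          case Nil
          with 2 True \<open>x < h\<close> show ?thesis by auto
        next
          case (Cons k t')
          have "knuth_triple [h, k, z] [h, z, k]"
            using True t(2)[of k] Cons by (intro knuth_triple.intros) auto
          with 2 True \<open>x < h\<close> Cons t(2)[of k] show ?thesis by auto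
        qed
      next
        case False
        obtain t2 b2 where t2: "row_insert z t = (t2, b2)" by fastforce
        obtain t3 b3 where t3: "row_insert y t2 = (t3, b3)" by fastforce
        have st2: "sorted t2" using sorted_row_insert[OF t(1), of z] t2 by simp
        have zt2: "z \<in> set t2"
        proof (cases b2)
          case None then show ?thesis using row_insert_NoneD t2 by fastforce
        next
          case (Some c) then show ?thesis using row_insert_SomeD[of z t t2 c] t2 by auto
        qed
        \<comment> \<open>The entry \<open>z\<close> is still in the row, so the smaller
          \<open>y\<close> must bump some \<open>e\<close> with \<open>e\<close> \<le>
          \<open>z\<close>. If \<open>z\<close> bumped \<open>c\<close>, then \<open>h\<close> \<le>
          \<open>e\<close> < \<open>c\<close>, which is the order a triple needs.\<close>
        obtain e where e: "b3 = Some e"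
          using row_insert_None_iff[of y t2] t3 zt2 \<open>y < z\<close> by (cases b3) auto
        have e1: "e \<le> z" "y < e"
          using row_insert_bumps_le[OF st2, of y t3 e z] row_insert_SomeD[of y t2 t3 e] t3 e zt2 \<open>y < z\<close>
          by auto
        have he: "h \<le> e"
        proof -
          have "e \<in> set t2" using row_insert_SomeD[of y t2 t3 e] t3 e by auto
          moreover have "set t2 \<subseteq> insert z (set t)"
          proof (cases b2)
            case None then show ?thesis using row_insert_NoneD t2 by fastforce
          next
            case (Some c) then show ?thesis using row_insert_SomeD[of z t t2 c] t2 by auto
          qed
          ultimately show ?thesis using t False by force
        qed
        have "knuth_triple [h, c, e] [c, h, e]" if "b2 = Some c" for c
        proof (rule knuth_triple.intros)
          show "h \<le> e" by fact
          show "e < c" using row_insert_SomeD[of z t t2 c] t2 that e1 by auto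
        qed
        then show ?thesis using 2 False \<open>x < h\<close> t2 t3 e
          by (auto split: option.splits)
      qed
    qed
  qed
qed

text \<open>Each row becomes the same for both words and hands down either equal words or another
  triple, to which the induction hypothesis applies.\<close>

lemma fold_tableau_insert_knuth_triple:
  assumes "\<forall>r\<in>set T. sorted r" "knuth_triple u v"
  shows "fold tableau_insert u T = fold tableau_insert v T"
  using assms
proof (induction T arbitrary: u v)
  case Nil
  then show ?case by (auto elim!: knuth_triple.cases)
next
  case (Cons r T)
  with row_insert_word_knuth_triple[of r u v] show ?case
    by (auto simp: fold_tableau_insert_Cons)
qed

lemma sorted_tableau_insert:
  "\<forall>r\<in>set T. sorted r \<Longrightarrow> \<forall>r\<in>set (tableau_insert x T). sorted r"
proof (induction x T rule: tableau_insert.induct)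
  case (2 x r rs)
  obtain r' b where "row_insert x r = (r', b)" by fastforce
  with 2 sorted_row_insert[of r x] show ?case
    by (auto split: option.splits)
qed simp

lemma insertion_tableau_Nil [simp]: "insertion_tableau [] = []"
  by (simp add: insertion_tableau_def)

lemma insertion_tableau_snoc:
  "insertion_tableau (w @ [x]) = tableau_insert x (insertion_tableau w)"
  by (simp add: insertion_tableau_def)

lemma sorted_insertion_tableau: "r \<in> set (insertion_tableau w) \<Longrightarrow> sorted r"
proof -
  have "\<forall>r\<in>set (insertion_tableau w). sorted r"
    by (induction w rule: rev_induct) (simp_all add: insertion_tableau_snoc sorted_tableau_insert)
  then show "r \<in> set (insertion_tableau w) \<Longrightarrow> sorted r" by blast
qed

theorem knuth_equiv_insertion_tableau:
  assumes "knuth_equiv u v"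
  shows "insertion_tableau u = insertion_tableau v"
proof (rule knuth_equiv_invariant[OF assms])
  fix u v :: "'a list"
  assume "knuth_step u v"
  then obtain us u' v' vs where "knuth_triple u' v'" "u = us @ u' @ vs" "v = us @ v' @ vs"
    unfolding knuth_step_iff by blast
  moreover from this have
    "fold tableau_insert u' (insertion_tableau us) = fold tableau_insert v' (insertion_tableau us)"
    using fold_tableau_insert_knuth_triple sorted_insertion_tableau by blast
  ultimately show "insertion_tableau u = insertion_tableau v"
    by (simp add: insertion_tableau_def)
qed

subsection \<open>Reading words\<close>

text \<open>The small letter \<open>x\<close> travels left through the row by moves of the first
  kind, each using the entry before the one it passes as witness; it stops behind \<open>y\<close>,
  where no witness is left.\<close>

lemma knuth_equiv_insert_second:
  "sorted (y # r) \<Longrightarrow> x < y \<Longrightarrow> knuth_equiv (y # r @ [x]) (y # x # r)"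
proof (induction r arbitrary: y)
  case (Cons z r)
  have "knuth_equiv (y # z # r @ [x]) (y # z # x # r)"
    by (rule knuth_equiv_context[of _ "[y]" "z # r @ [x]" "[]" _ "z # x # r"])
      (use Cons in auto)
  also have "knuth_equiv (y # z # x # r) (y # x # z # r)"
    using Cons.prems knuth_step.intros(1)[of x y z "[]" r] by (intro knuth_step_equiv) auto
  finally show ?case by simp
qed simp

text \<open>Two phases: the inserted letter travels left to its place, then the bumped letter
  \<open>y\<close> travels on to the front by moves of the second kind.\<close>

lemma knuth_equiv_row_insert_Some:
  "sorted r \<Longrightarrow> row_insert x r = (r', Some y) \<Longrightarrow> knuth_equiv (r @ [x]) (y # r')"
proof (induction r arbitrary: r')
  case (Cons h t)
  show ?case
  proof (cases "x < h")
    case True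
    with Cons knuth_equiv_insert_second[of h t x] show ?thesis by simp
  next
    case False
    with Cons.prems obtain t' where t: "row_insert x t = (t', Some y)" "r' = h # t'"
      by (auto split: prod.splits)
    \<comment> \<open>The move of \<open>y\<close> past \<open>h\<close> needs the next letter
      \<open>k\<close> as witness, with \<open>h\<close> \<le> \<open>k\<close> < \<open>y\<close>.
      It is the head of \<open>a\<close>, or \<open>x\<close> itself if \<open>a\<close> is
      empty.\<close>
    obtain k t'' where t': "t' = k # t''" "h \<le> k" "k < y"
    proof -
      obtain a b where ab: "x < y" "t = a @ y # b" "t' = a @ x # b" "\<forall>z\<in>set a. z \<le> x"
        using row_insert_SomeD[OF t(1)] by blast
      show ?thesis
      proof (cases a)
        case Nil with ab False that show ?thesis by auto
      next
        case (Cons k a') with ab Cons.prems(1) that[of k "a' @ x # b"] \<open>sorted (h # t)\<close> show ?thesis by auto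
      qed
    qed
    have "knuth_equiv (h # t @ [x]) (h # y # t')"
      by (rule knuth_equiv_context[of _ "[h]" "t @ [x]" "[]" _ "y # t'"])
        (use Cons.prems Cons.IH[OF _ t(1)] in auto)
    also have "knuth_equiv (h # y # t') (y # h # t')"
      using t' knuth_step.intros(2)[of h k y "[]" t''] by (intro knuth_step_equiv) auto
    finally show ?thesis using t by simp
  qed
qed simp

text \<open>Rows are read from the bottom up, so a letter pushed out at the left end of the first
  row stands right after the word of the lower rows, where the induction hypothesis inserts
  it.\<close>

lemma knuth_equiv_tableau_insert:
  "\<forall>r\<in>set T. sorted r \<Longrightarrow>
    knuth_equiv (concat (rev T) @ [x]) (concat (rev (tableau_insert x T)))"
proof (induction T arbitrary: x)
  case (Cons r T)
  obtain r' b where r': "row_insert x r = (r', b)" by fastforce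
  show ?case
  proof (cases b)
    case None
    with r' show ?thesis by (auto dest: row_insert_NoneD)
  next
    case (Some y)
    have "knuth_equiv (concat (rev T) @ r @ [x]) (concat (rev T) @ y # r')"
      by (rule knuth_equiv_context[of _ "concat (rev T)" "r @ [x]" "[]" _ "y # r'"])
        (use knuth_equiv_row_insert_Some[of r x r' y] Cons.prems r' Some in auto)
    also have "knuth_equiv (concat (rev T) @ y # r') (concat (rev (tableau_insert y T)) @ r')"
      by (rule knuth_equiv_context[OF _ _ Cons.IH, of _ "[]" y r']) (use Cons.prems in auto)
    finally show ?thesis using r' Some by simp
  qed
qed simp

theorem knuth_equiv_reading_word: "knuth_equiv w (concat (rev (insertion_tableau w)))"
proof (induction w rule: rev_induct)
  case (snoc x w)
  have "knuth_equiv (w @ [x]) (concat (rev (insertion_tableau w)) @ [x])"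
    using knuth_equiv_context[OF _ _ snoc, of _ "[]" "[x]"] by simp
  also have "knuth_equiv (concat (rev (insertion_tableau w)) @ [x])
      (concat (rev (insertion_tableau (w @ [x]))))"
    using knuth_equiv_tableau_insert[of "insertion_tableau w" x] sorted_insertion_tableau[of _ w]
    by (simp add: insertion_tableau_snoc)
  finally show ?case by simp
qed simp

lemma mset_insertion_tableau: "mset (concat (rev (insertion_tableau w))) = mset w"
  using knuth_equiv_mset[OF knuth_equiv_reading_word] by metis

subsection \<open>Shape of the insertion tableau\<close>

lemma tableau_insert_rows_nonempty: "[] \<notin> set T \<Longrightarrow> [] \<notin> set (tableau_insert x T)"
proof (induction x T rule: tableau_insert.induct)
  case (2 x r rs)
  obtain r' b where r': "row_insert x r = (r', b)" by fastforce
  then have "r' \<noteq> []" by (cases b) (auto dest: row_insert_NoneD row_insert_SomeD)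
  with 2 r' show ?case by (auto split: option.splits)
qed simp

lemma insertion_tableau_rows_nonempty: "[] \<notin> set (insertion_tableau w)"
  by (induction w rule: rev_induct) (simp_all add: insertion_tableau_snoc tableau_insert_rows_nonempty)

text \<open>A letter below the corner replaces it and any other letter passes it, so the corner
  remains the minimum.\<close>

lemma insertion_tableau_first_row:
  "w \<noteq> [] \<Longrightarrow> \<exists>h t rs. insertion_tableau w = (h # t) # rs \<and> (\<forall>z\<in>set w. h \<le> z)"
proof (induction w rule: rev_induct)
  case (snoc x w)
  show ?case
  proof (cases "w = []")
    case True
    then show ?thesis by (simp add: insertion_tableau_def)
  next
    case False
    with snoc obtain h t rs where T: "insertion_tableau w = (h # t) # rs" "\<forall>z\<in>set w. h \<le> z"
      by blast
    obtain t' b where "row_insert x t = (t', b)" by fastforce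
    with T show ?thesis
      by (cases b) (auto simp: insertion_tableau_snoc not_less intro: order_trans less_imp_le)
  qed
qed simp

lemma set_insertion_tableau: "set (concat (insertion_tableau w)) = set w"
  using arg_cong[OF mset_insertion_tableau, of set_mset, of w] by simp

lemma distinct_insertion_tableau:
  "distinct w \<Longrightarrow> distinct (concat (rev (insertion_tableau w)))"
  using mset_insertion_tableau mset_eq_imp_distinct_iff by metis

lemma strict_sorted_insertion_tableau:
  "distinct w \<Longrightarrow> r \<in> set (insertion_tableau w) \<Longrightarrow> sorted_wrt (<) r"
  using distinct_insertion_tableau[of w] sorted_insertion_tableau[of r w]
  by (auto simp: strict_sorted_iff distinct_concat_iff)

lemma length_row_insert: "row_insert x r = (r', b) \<Longrightarrow> length r \<le> length r'"
  by (cases b) (auto dest!: row_insert_NoneD row_insert_SomeD)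

text \<open>After \<open>a\<close> the corner is at most \<open>a\<close>, so \<open>b\<close> lands
  to its right; later insertions never shorten a row.\<close>

lemma length_hd_insertion_tableau_ge_2:
  assumes "a < b"
  shows "2 \<le> length (hd (insertion_tableau (u @ a # v @ b # w)))"
proof (induction w rule: rev_induct)
  case Nil
  obtain h t rs where "insertion_tableau (u @ a # v) = (h # t) # rs" "h \<le> a"
    using insertion_tableau_first_row[of "u @ a # v"] by auto
  moreover obtain t' b' where "row_insert b t = (t', b')" by fastforce
  moreover from this have "t' \<noteq> []" by (cases b') (auto dest: row_insert_NoneD row_insert_SomeD)
  ultimately show ?case using assms insertion_tableau_snoc[of "u @ a # v" b]
    by (cases t') (auto split: option.splits)
next
  case (snoc x w)
  obtain h t rs where "insertion_tableau (u @ a # v @ b # w) = (h # t) # rs"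
    using insertion_tableau_first_row[of "u @ a # v @ b # w"] by auto
  moreover obtain r' b' where "row_insert x (h # t) = (r', b')" by fastforce
  moreover from this have "length (h # t) \<le> length r'" by (rule length_row_insert)
  ultimately show ?case using snoc insertion_tableau_snoc[of "u @ a # v @ b # w" x]
    by (cases b') (auto simp del: row_insert.simps)
qed

subsection \<open>The avoidance class\<close>

text \<open>Both sides of every Knuth move contain an ascent, so a decreasing word is alone in its
  class.\<close>

lemma knuth_equiv_decreasing:
  assumes "knuth_equiv u v" "sorted_wrt (>) u"
  shows "v = u"
proof -
  have "\<not> sorted_wrt (>) u \<and> \<not> sorted_wrt (>) v" if "knuth_step u v" for u v :: "'a list"
    using that by cases (auto simp: sorted_wrt_append)
  note step = this
  from assms show ?thesis unfolding knuth_equiv_def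
    by (induction rule: equivclp_induct) (auto dest: step)
qed

text \<open>The letter 1 occurs only between \<open>u\<close> and \<open>v\<close>, so the
  occurrences are the pairs of increasing letters in \<open>u\<close>.\<close>

lemma avoids_pattern_231_min_append:
  assumes "distinct (u @ 1 # v)" "0 \<notin> set u"
  shows "avoids (u @ 1 # v) pattern_231_min \<longleftrightarrow> sorted_wrt (>) u"
proof -
  let ?w = "u @ 1 # v"
  have c: "?w ! c = 1 \<longleftrightarrow> c = length u" if "c < length ?w" for c
    using nth_eq_iff_index_eq[OF assms(1) that, of "length u"] by simp
  have pos: "1 < u ! a" if "a < length u" for a
  proof -
    have "u ! a \<in> set u" using that by simp
    with assms have "u ! a \<noteq> 0" "u ! a \<noteq> 1" by auto
    then show ?thesis by linarith
  qed
  have "\<not> avoids ?w pattern_231_min \<longleftrightarrow> (\<exists>a b. a < b \<and> b < length u \<and> u ! a < u ! b)"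
    (is "?L \<longleftrightarrow> ?R")
  proof
    assume ?L
    then obtain a b c where "a < b" "b < c" "c < length ?w" "?w ! c = 1" "?w ! a < ?w ! b"
      unfolding avoids_pattern_231_min_iff by blast
    moreover from this have "c = length u" using c by blast
    ultimately show ?R by (intro exI[of _ a] exI[of _ b]) (simp add: nth_append)
  next
    assume ?R
    then obtain a b where "a < b" "b < length u" "u ! a < u ! b" by blast
    then show ?L unfolding avoids_pattern_231_min_iff not_not using pos[of a]
      by (intro exI[of _ a] exI[of _ b] exI[of _ "length u"]) (simp add: nth_append)
  qed
  moreover have "u ! a < u ! b \<longleftrightarrow> \<not> u ! a > u ! b" if "a < b" "b < length u" for a b
    using that assms(1) nth_eq_iff_index_eq[of u a b] by fastforce
  ultimately show ?thesis by (auto simp: sorted_wrt_iff_nth_less)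
qed

lemma hook_shaped_altdef:
  "hook_shaped T \<longleftrightarrow> (\<exists>r c. r \<noteq> [] \<and> T = r # map (\<lambda>x. [x]) c)"
proof
  assume "hook_shaped T"
  then obtain k j where k: "k \<ge> 1" "map length T = k # replicate j 1"
    by (auto simp: hook_shaped_def)
  then obtain r rs where T: "T = r # rs" "length r = k" "map length rs = replicate j 1" by (cases T) auto
  have "[hd row] = row" if "row \<in> set rs" for row
  proof -
    have "length row = 1" using that arg_cong[OF T(3), of set] by (auto split: if_splits)
    then show ?thesis by (cases row) auto
  qed
  then have "map (\<lambda>row. [hd row]) rs = rs" by (intro map_idI) auto
  then have "T = r # map (\<lambda>x. [x]) (map hd rs)" using T by (simp add: comp_def)
  with T k show "\<exists>r c. r \<noteq> [] \<and> T = r # map (\<lambda>x. [x]) c" by (intro exI[of _ r] exI[of _ "map hd rs"]) auto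
next
  assume "\<exists>r c. r \<noteq> [] \<and> T = r # map (\<lambda>x. [x]) c"
  then obtain r c where "r \<noteq> []" "T = r # map (\<lambda>x. [x]) c" by blast
  then show "hook_shaped T" unfolding hook_shaped_def
    by (intro exI[of _ "length r"] exI[of _ "length c"])
      (auto simp: Suc_le_eq comp_def map_replicate_const)
qed

text \<open>As long as the second row is the single letter \<open>h < y\<close>, every letter bumped out of the first
  row is at least \<open>y\<close> and therefore lengthens the second row.\<close>

lemma insertion_tableau_ascent_before_min:
  assumes u: "u = u1 @ a # u2 @ b # u3" "a < b" "\<forall>z\<in>set u. 1 < z" "distinct u"
    and v: "\<forall>z\<in>set v. 1 < (z::nat)"
  shows "\<exists>y t h s rs. insertion_tableau (u @ 1 # v) = (1 # y # t) # (h # s) # rs \<and>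
    (s = [] \<longrightarrow> h < y \<and> 2 < y)"
  using v
proof (induction v rule: rev_induct)
  case Nil
  from u obtain m t0 rs where m: "insertion_tableau u = (m # t0) # rs"
    using insertion_tableau_first_row[of u] by auto
  with length_hd_insertion_tableau_ge_2[OF u(2), of u1 u2 u3] u(1)
  obtain y t where t0: "t0 = y # t" by (cases t0) auto
  have "m < y" using strict_sorted_insertion_tableau[OF u(4), of "m # t0"] m t0 by simp
  have "m \<in> set u" using set_insertion_tableau[of u] m by auto
  then have "1 < m" using u(3) by blast
  then have T: "insertion_tableau (u @ [1]) = (1 # y # t) # tableau_insert m rs"
    using m t0 by (simp add: insertion_tableau_snoc)
  \<comment> \<open>The corner \<open>m\<close> bumped by the 1 enters the second row. If that row
    has length one afterwards, its letter is \<open>m\<close>, and 1 < \<open>m\<close> <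
    \<open>y\<close> gives both required inequalities.\<close>
  have "\<exists>h s rs'. tableau_insert m rs = (h # s) # rs' \<and> (s = [] \<longrightarrow> h = m)"
  proof (cases rs)
    case (Cons r rs')
    with m insertion_tableau_rows_nonempty[of u] obtain k r' where r: "r = k # r'" by (cases r) auto
    obtain r1 b1 where "row_insert m r' = (r1, b1)" by fastforce
    moreover from this have "r1 \<noteq> []" by (cases b1) (auto dest: row_insert_NoneD row_insert_SomeD)
    ultimately show ?thesis using Cons r by (cases b1) auto
  qed simp
  then obtain h s rs' where "tableau_insert m rs = (h # s) # rs'" "s = [] \<longrightarrow> h = m" by blast
  with T \<open>1 < m\<close> \<open>m < y\<close> show ?case by auto
next
  case (snoc x v)
  then obtain y t h s rs where T: "insertion_tableau (u @ 1 # v) = (1 # y # t) # (h # s) # rs"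
    "s = [] \<longrightarrow> h < y \<and> 2 < y" by auto
  have "1 < x" using snoc.prems by simp
  obtain r b where row: "row_insert x (y # t) = (r, b)" by fastforce
  have "row_insert x (1 # y # t) = (1 # r, b)"
    using \<open>1 < x\<close> row by (subst row_insert.simps) simp
  then have T': "insertion_tableau (u @ 1 # v @ [x]) =
      (1 # r) # (case b of None \<Rightarrow> (h # s) # rs | Some z \<Rightarrow> tableau_insert z ((h # s) # rs))"
    using insertion_tableau_snoc[of "u @ 1 # v" x]
    unfolding T(1) append_assoc append_Cons tableau_insert.simps(2) by (simp split: option.split)
  show ?case
  proof (cases b)
    case None
    with row have "r = y # t @ [x]" by (auto dest!: row_insert_NoneD simp del: row_insert.simps)
    with T(2) T' None show ?thesis by simp
  next
    case (Some z)
    from length_row_insert[OF row] obtain y' t' where r: "r = y' # t'" by (cases r) auto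
    have "y \<le> z" using row Some by (auto split: if_splits prod.splits dest: row_insert_SomeD)
    obtain s' b' where s': "row_insert z (h # s) = (s', b')" by fastforce
    have "2 \<le> length s'"
    proof (cases s)
      case Nil
      with T(2) \<open>y \<le> z\<close> s' show ?thesis by auto
    next
      case (Cons k s1)
      with length_row_insert[OF s'] show ?thesis by simp
    qed
    then obtain h' s1 where "s' = h' # s1" "s1 \<noteq> []" by (cases s'; cases "tl s'") auto
    with T' Some r s' show ?thesis by (cases b') (simp_all del: row_insert.simps)
  qed
qed

text \<open>In a hook the second row is a single letter, so an ascent before the 1 would put some
  \<open>y\<close> > 2 right behind the corner, and the sorted first row would miss 2.\<close>

lemma avoids_if_hook:
  assumes "w \<in> permutations_of_set {1..n}" "1 \<le> n"
    and "hook_shaped (insertion_tableau w)" "2 \<in> set (hd (insertion_tableau w))"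
  shows "avoids w pattern_231_min"
proof -
  have w: "set w = {1..n}" "distinct w" using assms(1) by (auto simp: permutations_of_set_def)
  then have "1 \<in> set w" using assms(2) by simp
  then obtain u v where uv: "w = u @ 1 # v" using split_list by metis
  have gt: "1 < z" if "z \<in> set u \<union> set v" for z
  proof -
    have "z \<in> {1..n}" "z \<noteq> 1" using that w unfolding uv by auto
    then show ?thesis by auto
  qed
  have "sorted_wrt (>) u"
  proof (rule ccontr)
    assume "\<not> sorted_wrt (>) u"
    then obtain i j where ij: "i < j" "j < length u" "\<not> u ! i > u ! j"
      by (auto simp: sorted_wrt_iff_nth_less)
    moreover have "u ! i \<noteq> u ! j" using ij w(2) uv nth_eq_iff_index_eq[of u i j] by auto
    ultimately have lt: "u ! i < u ! j" by simp
    define u1 u2 u3 where "u1 = take i u" "u2 = take (j - Suc i) (drop (Suc i) u)" "u3 = drop (Suc j) u"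
    have "u = u1 @ u ! i # drop (Suc i) u" using ij unfolding u1_u2_u3_def
      by (simp add: id_take_nth_drop)
    moreover have "drop (Suc i) u = u2 @ u ! j # u3"
      using id_take_nth_drop[of "j - Suc i" "drop (Suc i) u"] ij unfolding u1_u2_u3_def by simp
    ultimately have u: "u = u1 @ u ! i # u2 @ u ! j # u3" by simp
    have "distinct u" "\<forall>z\<in>set u. 1 < z" "\<forall>z\<in>set v. 1 < z" using w(2) uv gt by auto
    from insertion_tableau_ascent_before_min[OF u lt this(2,1,3)]
    obtain y t h s rs where T: "insertion_tableau w = (1 # y # t) # (h # s) # rs"
      "s = [] \<longrightarrow> h < y \<and> 2 < y" unfolding uv by blast
    from assms(3) T have "s = []" unfolding hook_shaped_altdef by auto
    with T have "2 < y" by simp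
    moreover have "sorted (1 # y # t)" using sorted_insertion_tableau[of "1 # y # t" w] T by simp
    ultimately show False using assms(4) T by fastforce
  qed
  then show ?thesis unfolding uv
    using avoids_pattern_231_min_append[of u v] w gt uv by fastforce
qed

lemma rev_upt_conv_snoc: "1 \<le> n \<Longrightarrow> rev [1..<n + 1] = rev [2..<n + 1] @ [1]"
  by (subst upt_conv_Cons) (auto simp: numeral_2_eq_2 simp del: upt_Suc)

lemma sorted_wrt_rev_upt: "sorted_wrt (>) (rev [i..<j])"
  by (simp add: sorted_wrt_rev)

lemma rev_upt_permutation: "rev [1..<n + 1] \<in> permutations_of_set {1..n}"
  by (auto simp: permutations_of_set_def)

lemma knuth_equiv_permutation:
  "knuth_equiv u v \<Longrightarrow> u \<in> permutations_of_set A \<Longrightarrow> v \<in> permutations_of_set A"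
  using knuth_equiv_mset[of u v] mset_eq_setD[of u v] mset_eq_imp_distinct_iff[of u v]
  by (auto simp: permutations_of_set_def)

section \<open>Characterisation of the avoidance class\<close>

lemma class_avoiders_eq:
  assumes "1 \<le> n"
  shows "class_avoiders knuth_equiv pattern_231_min n =
    {\<pi> \<in> permutations_of_set {1..n}.
       hook_shaped (insertion_tableau \<pi>) \<and> 2 \<in> set (hd (insertion_tableau \<pi>))}
    \<union> {rev [1..<n + 1]}" (is "?C = ?H \<union> _")
proof (intro equalityI subsetI)
  fix w assume "w \<in> ?H \<union> {rev [1..<n + 1]}"
  then consider "w \<in> ?H" | "w = rev [1..<n + 1]" by blast
  then show "w \<in> ?C"
  proof cases
    case 1
    then have "avoids v pattern_231_min" if "knuth_equiv w v" "v \<in> permutations_of_set {1..n}" for v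
      using avoids_if_hook[OF that(2) assms] knuth_equiv_insertion_tableau[OF that(1)] by simp
    with 1 show ?thesis unfolding class_avoiders_def by simp
  next
    case 2
    have "avoids w pattern_231_min"
      unfolding 2 rev_upt_conv_snoc[OF assms]
      by (subst avoids_pattern_231_min_append)
        (use sorted_wrt_rev_upt[of 2 "n + 1"] in \<open>auto simp del: upt_Suc\<close>)
    moreover have "v = w" if "knuth_equiv w v" for v
      using knuth_equiv_decreasing[OF that] 2 sorted_wrt_rev_upt by simp
    moreover have "w \<in> permutations_of_set {1..n}" unfolding 2 by (rule rev_upt_permutation)
    ultimately show ?thesis unfolding class_avoiders_def by blast
  qed
next
  fix p assume p: "p \<in> ?C"
  then have p_perm: "p \<in> permutations_of_set {1..n}" by (simp add: class_avoiders_def)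
  have av: "v \<in> permutations_of_set {1..n} \<and> avoids v pattern_231_min" if "knuth_equiv p v" for v
    using p knuth_equiv_permutation[OF that p_perm] that unfolding class_avoiders_def by simp
  have pset: "set p = {1..n}" and pdist: "distinct p"
    using p_perm by (auto simp: permutations_of_set_def)
  with assms have "p \<noteq> []" by auto
  then obtain h v rs where T: "insertion_tableau p = (h # v) # rs" and h: "\<forall>z\<in>set p. h \<le> z"
    using insertion_tableau_first_row by blast
  have "h \<in> set p" using set_insertion_tableau[of p] T by auto
  with h pset assms have "h = 1" by force
  define u where "u = concat (rev rs)"
  have equiv: "knuth_equiv p (u @ 1 # v)"
    using knuth_equiv_reading_word[of p] T \<open>h = 1\<close> by (simp add: u_def)
  have w: "set (u @ 1 # v) = {1..n}" "distinct (u @ 1 # v)" "avoids (u @ 1 # v) pattern_231_min"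
    using av[OF equiv] unfolding permutations_of_set_def by blast+
  have "0 \<notin> set u" using w(1) by auto
  with w have u: "sorted_wrt (>) u" using avoids_pattern_231_min_append by blast
  \<comment> \<open>A lower row is increasing, but as a factor of the decreasing word
    \<open>u\<close> it is also decreasing.\<close>
  have "length r = 1" if "r \<in> set rs" for r
  proof -
    from that obtain rs1 rs2 where "rs = rs1 @ r # rs2" by (metis split_list)
    with u have "sorted_wrt (>) r" by (simp add: u_def sorted_wrt_append)
    moreover have "sorted r" using sorted_insertion_tableau[of r p] T that by simp
    moreover have "r \<noteq> []" using insertion_tableau_rows_nonempty[of p] T that by auto
    ultimately show ?thesis by (cases r; cases "tl r") auto
  qed
  then have "map length rs = replicate (length rs) 1" by (induction rs) auto
  then have hook: "hook_shaped (insertion_tableau p)"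
    unfolding hook_shaped_def T by (intro exI[of _ "length (h # v)"] exI[of _ "length rs"]) simp
  show "p \<in> ?H \<union> {rev [1..<n + 1]}"
  proof (cases v)
    \<comment> \<open>If the first row is just 1, the whole reading word is decreasing, and its
      class has no other member.\<close>
    case Nil
    have "1 < z" if "z \<in> set u" for z
    proof -
      from that w have "z \<in> {1..n}" "z \<noteq> 1" by auto
      then show ?thesis by simp
    qed
    then have "sorted_wrt (>) (u @ [1])" using u by (simp add: sorted_wrt_append)
    then have "sorted_wrt (<) (rev (u @ [1]))" by (simp only: sorted_wrt_rev)
    then have "rev (u @ [1]) = [1..<n + 1]"
      using w Nil by (intro sorted_distinct_set_unique) (auto simp: strict_sorted_iff simp del: upt_Suc)
    then have "u @ [1] = rev [1..<n + 1]" by (metis rev_rev_ident)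
    with equiv Nil have "knuth_equiv p (rev [1..<n + 1])" by (simp del: upt_Suc)
    then have "knuth_equiv (rev [1..<n + 1]) p" by (rule knuth_equiv_sym)
    then have "p = rev [1..<n + 1]" using knuth_equiv_decreasing sorted_wrt_rev_upt by blast
    then show ?thesis by simp
  next
    case (Cons a v')
    have "2 \<in> set (1 # v)"
    proof (rule ccontr)
      assume n2: "2 \<notin> set (1 # v)"
      have "a \<in> {1..n}" "a \<noteq> 1" "a \<noteq> 2" using w n2 Cons by auto
      then have a: "2 < a" "2 \<le> n" by auto
      then have "2 \<in> set (u @ 1 # v)" using w(1) by simp
      with n2 have "2 \<in> set u" by auto
      \<comment> \<open>As \<open>u\<close> is decreasing with letters above 1, the letter 2 is its
        last one and stands next to the 1.\<close>
      then obtain u' e where ue: "u = u' @ [e]" by (cases u rule: rev_cases) auto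
      have "e \<le> 2" using u \<open>2 \<in> set u\<close> ue by (auto simp: sorted_wrt_append)
      moreover have "e \<in> {1..n}" "e \<noteq> 1" using w ue by auto
      ultimately have "e = 2" by auto
      \<comment> \<open>The first kind of move for the letters 1 < 2 < \<open>a\<close>, read
        backwards, produces a member of the class with the ascent 2 \<open>a\<close> before the
        1.\<close>
      have "knuth_step (u' @ [2, a, 1] @ v') (u' @ [2, 1, a] @ v')"
        using a by (intro knuth_step.intros) auto
      then have "knuth_equiv (u' @ [2, a, 1] @ v') (u @ 1 # v)"
        using knuth_step_equiv ue \<open>e = 2\<close> Cons by fastforce
      then have "knuth_equiv p (u' @ [2, a, 1] @ v')"
        using equiv knuth_equiv_sym knuth_equiv_trans by blast
      with av have "avoids ((u' @ [2, a]) @ 1 # v') pattern_231_min" by simp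
      moreover have "distinct ((u' @ [2, a]) @ 1 # v')" "0 \<notin> set (u' @ [2, a])"
        using w ue \<open>e = 2\<close> Cons a \<open>0 \<notin> set u\<close> by auto
      ultimately have "sorted_wrt (>) (u' @ [2, a])" using avoids_pattern_231_min_append by blast
      with a show False by (simp add: sorted_wrt_append)
    qed
    then show ?thesis using p_perm hook T \<open>h = 1\<close> by simp
  qed
qed

subsection \<open>Congruences of even cycles\<close>

lemma fibre_partition_altdef: "fibre_partition V f = (\<lambda>x. {z \<in> V. f z = f x}) ` V"
  unfolding fibre_partition_def image_image ..

text \<open>A partition into fibres is determined by the kernel relation. The codomains may differ,
  which allows comparing an endomorphism with its integer-valued lift.\<close>

lemma fibre_partition_eq_iff:
  "fibre_partition V f = fibre_partition V g \<longleftrightarrow> (\<forall>x\<in>V. \<forall>y\<in>V. f x = f y \<longleftrightarrow> g x = g y)"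
proof
  have *: "h' x = h' y" if eq: "fibre_partition V h = fibre_partition V h'"
    and "x \<in> V" "y \<in> V" "h x = h y" for x y and h :: "'a \<Rightarrow> 'd" and h' :: "'a \<Rightarrow> 'e"
  proof -
    have "{z \<in> V. h z = h x} \<in> fibre_partition V h"
      using \<open>x \<in> V\<close> unfolding fibre_partition_altdef by blast
    then have "{z \<in> V. h z = h x} \<in> fibre_partition V h'" by (simp only: eq)
    then obtain w where "{z \<in> V. h z = h x} = {z \<in> V. h' z = h' w}"
      unfolding fibre_partition_altdef by blast
    moreover have "x \<in> {z \<in> V. h z = h x}" "y \<in> {z \<in> V. h z = h x}" using that by auto
    ultimately show ?thesis by auto
  qed
  show "\<forall>x\<in>V. \<forall>y\<in>V. f x = f y \<longleftrightarrow> g x = g y" if "fibre_partition V f = fibre_partition V g"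
    using *[OF that] *[OF that[symmetric]] by blast
  show "fibre_partition V f = fibre_partition V g" if "\<forall>x\<in>V. \<forall>y\<in>V. f x = f y \<longleftrightarrow> g x = g y"
    unfolding fibre_partition_altdef using that by (intro image_cong) auto
qed

text \<open>Turns edge preservation into the form of a closed walk with steps +1 or -1 modulo
  \<open>k\<close>.\<close>

lemma graph_endomorphisms_cycle_graph:
  "f \<in> graph_endomorphisms (cycle_graph k) \<longleftrightarrow>
    (\<forall>i<k. f i < k \<and> (f ((i + 1) mod k) = (f i + 1) mod k \<or> f i = (f ((i + 1) mod k) + 1) mod k))"
proof -
  have "{a, b} \<in> {{j, (j + 1) mod k} | j. j < k} \<longleftrightarrow> b = (a + 1) mod k \<or> a = (b + 1) mod k"
    if "a < k" "b < k" for a b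
    using that by (auto simp: doubleton_eq_iff)
  moreover have "(i + 1) mod k < k" if "i < k" for i using that by (intro mod_less_divisor) auto
  moreover have "f \<in> graph_endomorphisms (cycle_graph k) \<longleftrightarrow> (\<forall>i<k. f i < k) \<and>
      (\<forall>i<k. f ` {i, (i + 1) mod k} \<in> {{j, (j + 1) mod k} | j. j < k})"
    unfolding graph_endomorphisms_def cycle_graph_def fst_conv snd_conv mem_Collect_eq
      image_subset_iff atLeast0LessThan lessThan_iff Ball_def
    by blast
  ultimately show ?thesis unfolding image_insert image_empty by auto
qed

section \<open>Closed walks on the cycle, lifted to the integers\<close>

text \<open>The lift, started at 0, of the walk whose up-steps are the indices in \<open>U\<close>;
  all other steps go down.\<close>

definition height :: "nat set \<Rightarrow> nat \<Rightarrow> int" where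
  "height U i = (\<Sum>j<i. if j \<in> U then 1 else - 1)"

lemma height_0 [simp]: "height U 0 = 0"
  and height_Suc: "height U (Suc i) = height U i + (if i \<in> U then 1 else - 1)"
  by (simp_all add: height_def)

lemma height_diff:
  "i \<le> j \<Longrightarrow>
    height U j - height U i = int (card ({i..<j} \<inter> U)) - int (card ({i..<j} - U))"
proof (induction j rule: dec_induct)
  case (step j)
  then have "{i..<Suc j} = insert j {i..<j}" by auto
  with step show ?case by (auto simp: height_Suc Int_insert_left insert_Diff_if)
qed simp

lemma height_full:
  assumes "U \<subseteq> {0..<k}"
  shows "height U k = 2 * int (card U) - int k"
proof -
  have "finite U" "card U \<le> k" using assms card_mono[of "{0..<k}" U] finite_subset by auto
  with assms show ?thesis using height_diff[of 0 k U]
    by (simp add: Int_absorb1 card_Diff_subset of_nat_diff)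
qed

text \<open>Any segment of the walk contains at most m up-steps and at most m down-steps.\<close>

lemma height_diff_bound:
  assumes "U \<subseteq> {0..<2 * m}" "card U = m" "i \<le> 2 * m" "j \<le> 2 * m"
  shows "\<bar>height U i - height U j\<bar> \<le> int m"
proof -
  have fin: "finite U" using assms(1) finite_subset by blast
  have *: "\<bar>height U j - height U i\<bar> \<le> int m" if "i \<le> j" "j \<le> 2 * m" for i j
  proof -
    have "card ({i..<j} \<inter> U) \<le> card U" using fin by (intro card_mono) auto
    moreover have "card ({i..<j} - U) \<le> card ({0..<2 * m} - U)"
      using that by (intro card_mono) auto
    moreover have "card ({0..<2 * m} - U) = m"
      using assms fin by (simp add: card_Diff_subset)
    ultimately show ?thesis using height_diff[OF \<open>i \<le> j\<close>, of U] assms(2) by linarith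
  qed
  show ?thesis using *[of i j] *[of j i] assms(3,4) by (cases "i \<le> j") (auto simp: abs_minus_commute)
qed

text \<open>Heights differ by at most m < 2m, so reduction modulo 2m identifies no two distinct
  ones.\<close>

lemma dvd_height_diff_iff:
  assumes "U \<subseteq> {0..<2 * m}" "card U = m" "0 < m" "i \<le> 2 * m" "j \<le> 2 * m"
  shows "int (2 * m) dvd height U i - height U j \<longleftrightarrow> height U i = height U j"
proof
  assume "int (2 * m) dvd height U i - height U j"
  then show "height U i = height U j"
    using height_diff_bound[OF assms(1,2,4,5)] \<open>0 < m\<close> zdvd_imp_le[of "int (2 * m)" "\<bar>height U i - height U j\<bar>"]
    by auto
qed simp

lemma dvd_int_mod_diff: "int k dvd int (a mod k) - int a"
  by (simp add: zmod_int mod_eq_dvd_iff[symmetric])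

text \<open>Adding up the steps recovers \<open>f\<close> modulo \<open>k\<close>. The range
  includes \<open>i\<close> = \<open>k\<close>, where \<open>i mod k\<close> is 0: that instance
  says that the walk closes up. A step to which both signs apply, as can happen for small
  \<open>k\<close>, counts as up.\<close>

lemma cycle_endomorphism_height:
  assumes f: "f \<in> graph_endomorphisms (cycle_graph k)"
  defines "U \<equiv> {i \<in> {0..<k}. f ((i + 1) mod k) = (f i + 1) mod k}"
  assumes "i \<le> k"
  shows "int k dvd int (f (i mod k)) - int (f 0) - height U i"
  using \<open>i \<le> k\<close>
proof (induction i)
  case (Suc i)
  then have i: "i < k" "i mod k = i" by auto
  let ?i' = "Suc i mod k"
  from f i have step: "f ?i' = (f i + 1) mod k \<or> f i = (f ?i' + 1) mod k"
    unfolding graph_endomorphisms_cycle_graph by fastforce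
  have IH: "int k dvd int (f i) - int (f 0) - height U i" using Suc i by simp
  have "int k dvd int (f ?i') - int (f i) - (if i \<in> U then 1 else - 1)"
  proof (cases "i \<in> U")
    case True
    then have "f ?i' = (f i + 1) mod k" by (simp add: U_def)
    then show ?thesis using True dvd_int_mod_diff[of k "f i + 1"] by (simp add: algebra_simps)
  next
    case False
    with step i have "f i = (f ?i' + 1) mod k" by (auto simp: U_def)
    then have "int k dvd int (f i) - int (f ?i' + 1)" using dvd_int_mod_diff[of k "f ?i' + 1"] by simp
    then have "int k dvd - (int (f i) - int (f ?i' + 1))" by (simp only: dvd_minus_iff)
    then show ?thesis using False by (simp add: algebra_simps)
  qed
  from dvd_add[OF this IH] show ?case by (simp add: height_Suc algebra_simps)
qed simp

lemma graph_congruences_even_cycle: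
  assumes "0 < m"
  shows "graph_congruences (cycle_graph (2 * m)) =
    insert (fibre_partition {0..<2 * m} id)
      ((\<lambda>U. fibre_partition {0..<2 * m} (height U)) ` {U. U \<subseteq> {0..<2 * m} \<and> card U = m})"
    (is "_ = insert ?D (?F ` ?S)")
proof -
  have V: "fst (cycle_graph (2 * m)) = {0..<2 * m}" by (simp add: cycle_graph_def)
  have "fibre_partition {0..<2 * m} f \<in> insert ?D (?F ` ?S)"
    if f: "f \<in> graph_endomorphisms (cycle_graph (2 * m))" for f
  proof -
    define U where "U = {i \<in> {0..<2 * m}. f ((i + 1) mod (2 * m)) = (f i + 1) mod (2 * m)}"
    note dvd = cycle_endomorphism_height[OF f, folded U_def]
    have U: "U \<subseteq> {0..<2 * m}" "finite U" by (auto simp: U_def)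
    \<comment> \<open>Modulo 2m, \<open>f\<close> and the height differ by the constant
      \<open>f 0\<close>.\<close>
    have ker: "f x = f y \<longleftrightarrow> int (2 * m) dvd height U x - height U y" if "x < 2 * m" "y < 2 * m" for x y
    proof -
      have "int (2 * m) dvd (int (f x) - int (f 0) - height U x) - (int (f y) - int (f 0) - height U y)"
        using dvd_diff[OF dvd[of x] dvd[of y]] that by simp
      then have "int (2 * m) dvd (int (f x) - int (f y)) - (height U x - height U y)"
        by (simp add: algebra_simps)
      then have "int (2 * m) dvd int (f x) - int (f y) \<longleftrightarrow> int (2 * m) dvd height U x - height U y"
        using dvd_diff_left_iff dvd_diff_right_iff by (metis diff_add_cancel dvd_add_right_iff)
      moreover have "f x < 2 * m" "f y < 2 * m"
        using f that unfolding graph_endomorphisms_cycle_graph by auto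
      then have "int (2 * m) dvd int (f x) - int (f y) \<longleftrightarrow> f x = f y"
        by (simp flip: mod_eq_dvd_iff)
      ultimately show ?thesis by simp
    qed
    \<comment> \<open>Closing up means that 2m divides 2 \<open>card U\<close> - 2m, so
      \<open>card U\<close> is 0, m or 2m: all steps down, a balanced walk, or all steps up.\<close>
    have "int (2 * m) dvd - height U (2 * m)" using dvd[of "2 * m"] by simp
    then obtain c where "- height U (2 * m) = int (2 * m) * c" by (elim dvdE)
    then have "int (card U) = int m * (1 - c)"
      using height_full[OF U(1)] by (simp add: algebra_simps)
    then have "m dvd card U" by (metis dvd_triv_left int_dvd_int_iff)
    then obtain q where q: "card U = m * q" by (auto elim!: dvdE)
    moreover have cU: "card U \<le> 2 * m" using U(1) card_mono[of "{0..<2 * m}" U] by simp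
    ultimately have "m * q \<le> m * 2" by simp
    then have "q \<le> 2" using \<open>0 < m\<close> by simp
    then consider "q = 0" | "q = 1" | "q = 2" by linarith
    then show ?thesis
    proof cases
      case 1
      with q U have "U = {}" by simp
      then have h: "height U i = - int i" for i by (simp add: height_def)
      have "f x = f y \<longleftrightarrow> id x = id y" if "x < 2 * m" "y < 2 * m" for x y
        unfolding ker[OF that] h using that
        by (simp add: dvd_diff_commute flip: mod_eq_dvd_iff)
      then have "fibre_partition {0..<2 * m} f = ?D" by (simp add: fibre_partition_eq_iff)
      then show ?thesis by simp
    next
      case 2
      with q have "card U = m" by simp
      then have "f x = f y \<longleftrightarrow> height U x = height U y" if "x < 2 * m" "y < 2 * m" for x y
        using ker[OF that] dvd_height_diff_iff[OF U(1) _ \<open>0 < m\<close>, of x y] that by simp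
      then have "fibre_partition {0..<2 * m} f = ?F U" by (simp add: fibre_partition_eq_iff)
      with U \<open>card U = m\<close> show ?thesis by blast
    next
      case 3
      with q U have U: "U = {0..<2 * m}" by (intro card_subset_eq) auto
      have h: "height U i = int i" if "i \<le> 2 * m" for i
        using that by (induction i) (auto simp: height_Suc U)
      have "f x = f y \<longleftrightarrow> id x = id y" if "x < 2 * m" "y < 2 * m" for x y
        using ker[OF that] h[of x] h[of y] that by (simp flip: mod_eq_dvd_iff)
      then have "fibre_partition {0..<2 * m} f = ?D" by (simp add: fibre_partition_eq_iff)
      then show ?thesis by simp
    qed
  qed
  moreover have "?D \<in> graph_congruences (cycle_graph (2 * m))"
  proof -
    have "id \<in> graph_endomorphisms (cycle_graph (2 * m))"
      by (auto simp: graph_endomorphisms_def)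
    then show ?thesis unfolding graph_congruences_def V by blast
  qed
  moreover have "?F U \<in> graph_congruences (cycle_graph (2 * m))"
    if U: "U \<subseteq> {0..<2 * m}" "card U = m" for U
  proof -
    \<comment> \<open>Conversely, the balanced walk with up-steps \<open>U\<close> is read modulo
      2m.\<close>
    define f where "f i = nat (height U i mod int (2 * m))" for i
    have f: "int (f i) = height U i mod int (2 * m)" for i
      using \<open>0 < m\<close> by (simp add: f_def)
    have lt: "f i < 2 * m" for i
      using \<open>0 < m\<close> f[of i] pos_mod_bound[of "int (2 * m)" "height U i"] by linarith
    \<comment> \<open>The closing edge is respected because a balanced walk returns to height 0
      after 2m steps.\<close>
    have wrap: "f (Suc i mod (2 * m)) = f (Suc i)" if "i < 2 * m" for i
    proof (cases "Suc i = 2 * m")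
      case True
      then show ?thesis using height_full[OF U(1)] U(2) by (simp add: f_def)
    next
      case False
      with that show ?thesis by simp
    qed
    have "f (Suc i) = (f i + 1) mod (2 * m)" if "i \<in> U" for i
    proof -
      have "int (f (Suc i)) = int ((f i + 1) mod (2 * m))"
        unfolding f zmod_int using that by (simp add: f height_Suc mod_simps ac_simps)
      then show ?thesis by simp
    qed
    moreover have "f i = (f (Suc i) + 1) mod (2 * m)" if "i \<notin> U" for i
    proof -
      have "int (f i) = int ((f (Suc i) + 1) mod (2 * m))"
        unfolding f zmod_int using that by (simp add: f height_Suc mod_simps ac_simps)
      then show ?thesis by simp
    qed
    ultimately have "f \<in> graph_endomorphisms (cycle_graph (2 * m))"
      unfolding graph_endomorphisms_cycle_graph using lt wrap by auto
    moreover have "f x = f y \<longleftrightarrow> height U x = height U y" if "x < 2 * m" "y < 2 * m" for x y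
    proof -
      have "f x = f y \<longleftrightarrow> int (f x) = int (f y)" by simp
      also have "\<dots> \<longleftrightarrow> int (2 * m) dvd height U x - height U y"
        unfolding f by (rule mod_eq_dvd_iff)
      also have "\<dots> \<longleftrightarrow> height U x = height U y"
        using dvd_height_diff_iff[OF U \<open>0 < m\<close>] that by simp
      finally show ?thesis .
    qed
    then have "fibre_partition {0..<2 * m} f = ?F U" by (simp add: fibre_partition_eq_iff)
    ultimately show ?thesis unfolding graph_congruences_def V by (metis imageI)
  qed
  ultimately show ?thesis unfolding graph_congruences_def V by blast
qed

section \<open>Number of congruences of an even cycle\<close>

text \<open>The fibres thus show whether two consecutive steps have opposite signs, so the steps can
  be read off one after another from the first.\<close>

lemma height_eq_Suc_Suc_iff: "height U i = height U (Suc (Suc i)) \<longleftrightarrow> (i \<in> U \<longleftrightarrow> Suc i \<notin> U)"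
  by (auto simp: height_Suc)

text \<open>Complementing \<open>U\<close> negates all heights and keeps the fibres, so 0 may be
  assumed to lie in \<open>U\<close>; the other m-1 up-steps are chosen among 2m-1 indices. The
  summand 1 is the partition into singletons, which for m \<ge> 2 comes from no balanced
  walk.\<close>

lemma card_graph_congruences_even_cycle:
  assumes "2 \<le> m"
  shows "card (graph_congruences (cycle_graph (2 * m))) = ((2 * m - 1) choose (m - 1)) + 1"
proof -
  let ?V = "{0..<2 * m}"
  let ?F = "\<lambda>U. fibre_partition ?V (height U)"
  define S where "S = {U. U \<subseteq> ?V \<and> card U = m}"
  define S0 where "S0 = {U \<in> S. 0 \<in> U}"
  have Sfin: "finite U" "U \<subseteq> ?V" "card U = m" if "U \<in> S" for U
    using that finite_subset unfolding S_def by auto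
  have "?F ` S = ?F ` S0"
  proof
    show "?F ` S \<subseteq> ?F ` S0"
    proof
      fix P assume "P \<in> ?F ` S"
      then obtain U where U: "U \<in> S" "P = ?F U" by blast
      show "P \<in> ?F ` S0"
      proof (cases "0 \<in> U")
        case True
        with U show ?thesis by (auto simp: S0_def)
      next
        case False
        let ?U = "?V - U"
        have "?U \<in> S0" using Sfin[OF U(1)] False assms by (auto simp: S0_def S_def card_Diff_subset)
        moreover have "height ?U i = - height U i" if "i \<le> 2 * m" for i
          using that by (induction i) (auto simp: height_Suc)
        then have "?F U = ?F ?U" unfolding fibre_partition_eq_iff by simp
        ultimately show ?thesis using U(2) by blast
      qed
    qed
  qed (auto simp: S0_def)
  moreover have "inj_on ?F S0"
  proof (rule inj_onI)
    fix U U' assume U: "U \<in> S0" "U' \<in> S0" and "?F U = ?F U'"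
    then have eq: "height U x = height U y \<longleftrightarrow> height U' x = height U' y"
      if "x < 2 * m" "y < 2 * m" for x y
      using that unfolding fibre_partition_eq_iff by simp
    have "i \<in> U \<longleftrightarrow> i \<in> U'" if "Suc i < 2 * m" for i
      using that
    proof (induction i)
      case 0 then show ?case using U by (simp add: S0_def)
    next
      case (Suc i)
      with eq[of i "Suc (Suc i)"] show ?case by (simp add: height_eq_Suc_Suc_iff) blast
    qed
    moreover have "Suc i < 2 * m" if "i \<in> U \<union> U' - {2 * m - 1}" for i
    proof -
      from that U have "i < 2 * m" "i \<noteq> 2 * m - 1" unfolding S0_def S_def by auto
      then show ?thesis by linarith
    qed
    ultimately have *: "U - {2 * m - 1} = U' - {2 * m - 1}" by blast
    \<comment> \<open>Heights are compared only at indices below 2m, so the fibres do not show the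
      last step; it is settled by \<open>card U\<close> = m.\<close>
    have "finite U" "finite U'" "card U = m" "card U' = m" using U Sfin unfolding S0_def by auto
    with arg_cong[OF *, of card] assms have "2 * m - 1 \<in> U \<longleftrightarrow> 2 * m - 1 \<in> U'"
      by (simp add: card_Diff_singleton_if split: if_splits)
    with * show "U = U'" by blast
  qed
  moreover have "card S0 = (2 * m - 1) choose (m - 1)"
  proof -
    let ?T = "{W. W \<subseteq> {1..<2 * m} \<and> card W = m - 1}"
    have "bij_betw (insert 0) ?T S0"
    proof (rule bij_betwI[where g = "\<lambda>U. U - {0}"])
      show "insert 0 \<in> ?T \<rightarrow> S0"
      proof
        fix W assume W: "W \<in> ?T"
        then have "finite W" "0 \<notin> W" by (auto intro: finite_subset)
        with W assms show "insert 0 W \<in> S0" by (auto simp: S0_def S_def)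
      qed
      show "(\<lambda>U. U - {0}) \<in> S0 \<rightarrow> ?T"
        using Sfin unfolding S0_def by (auto simp: Suc_le_eq) (metis atLeastLessThan_iff subsetD)
    qed (auto simp: S0_def)
    then have "card S0 = card ?T" by (simp add: bij_betw_same_card)
    also have "\<dots> = (2 * m - 1) choose (m - 1)" using n_subsets[of "{1..<2 * m}" "m - 1"] by simp
    finally show ?thesis .
  qed
  moreover have "fibre_partition ?V id \<notin> ?F ` S0"
  proof
    assume "fibre_partition ?V id \<in> ?F ` S0"
    then obtain U where U: "U \<in> S0" and "?F U = fibre_partition ?V id" by auto
    then have eq: "height U x = height U y \<longleftrightarrow> x = y" if "x < 2 * m" "y < 2 * m" for x y
      using that unfolding fibre_partition_eq_iff by simp
    have "i \<in> U" if "Suc i < 2 * m" for i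
      using that
    proof (induction i)
      case 0 then show ?case using U by (simp add: S0_def)
    next
      case (Suc i)
      with eq[of i "Suc (Suc i)"] show ?case by (simp add: height_eq_Suc_Suc_iff)
    qed
    \<comment> \<open>Without turns all steps except possibly the last go up, giving 2m-1 \<le> m,
      which fails for m \<ge> 2.\<close>
    then have "{0..<2 * m - 1} \<subseteq> U" by auto
    then have "2 * m - 1 \<le> card U" using U Sfin card_mono[of U "{0..<2 * m - 1}"] by (auto simp: S0_def)
    with U Sfin assms show False by (auto simp: S0_def)
  qed
  moreover have "finite S0" by (rule finite_subset[of _ "Pow ?V"]) (auto simp: S0_def S_def)
  ultimately show ?thesis
    using graph_congruences_even_cycle[of m] assms by (simp add: card_image flip: S_def)
qed

subsection \<open>Counting words with a given hook tableau\<close>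

text \<open>Here \<open>c\<close> is the leg only: the corner belongs to \<open>r\<close>.\<close>

definition hook_tableau :: "'a list \<Rightarrow> 'a list \<Rightarrow> 'a list list" where
  "hook_tableau r c = r # map (\<lambda>x. [x]) c"

lemma hook_tableau_inject [simp]: "hook_tableau r c = hook_tableau r' c' \<longleftrightarrow> r = r' \<and> c = c'"
  by (auto simp: hook_tableau_def inj_map_eq_map inj_def)

lemma mset_hook_tableau: "mset (concat (rev (hook_tableau r c))) = mset (r @ c)"
  by (induction c) (auto simp: hook_tableau_def)

lemma tableau_insert_column:
  "sorted_wrt (<) (y # c) \<Longrightarrow> tableau_insert y (map (\<lambda>x. [x]) c) = map (\<lambda>x. [x]) (y # c)"
  by (induction c arbitrary: y) auto

text \<open>A nonempty row that has length one after an insertion had its only letter bumped, so the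
  old column has moved down by one cell.\<close>

lemma tableau_insert_eq_columnD:
  "tableau_insert y T = map (\<lambda>x. [x]) c \<Longrightarrow> [] \<notin> set T \<Longrightarrow>
    \<exists>c'. T = map (\<lambda>x. [x]) c' \<and> c = y # c' \<and> (c' \<noteq> [] \<longrightarrow> y < hd c')"
proof (induction T arbitrary: y c)
  case Nil
  then show ?case by (intro exI[of _ "[]"]) auto
next
  case (Cons r T)
  obtain r' b where r': "row_insert y r = (r', b)" by fastforce
  with Cons.prems obtain c0 c1 where c: "c = c0 # c1" "r' = [c0]"
    by (cases c; cases b) auto
  show ?case
  proof (cases b)
    case None
    with r' c Cons.prems show ?thesis by (auto dest: row_insert_NoneD)
  next
    case (Some z)
    with r' c have "y < z" "r = [z]" "c0 = y"
      by (auto dest!: row_insert_SomeD simp: Cons_eq_append_conv)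
    moreover from Some r' c Cons.prems have "tableau_insert z T = map (\<lambda>x. [x]) c1" by simp
    with Cons obtain c' where "T = map (\<lambda>x. [x]) c'" "c1 = z # c'" by auto
    ultimately show ?thesis using c by (intro exI[of _ "z # c'"]) auto
  qed
qed

text \<open>The ways to undo an insertion that ends in a hook: the tableau was empty, the letter was
  appended to the first row, or it bumped the letter \<open>y\<close> that now tops the leg.\<close>

lemma tableau_insert_eq_hook_tableauD:
  assumes "tableau_insert x T = hook_tableau r c" "[] \<notin> set T"
  obtains "T = []" "r = [x]" "c = []"
    | r' where "T = hook_tableau r' c" "r' \<noteq> []" "r = r' @ [x]" "\<forall>z\<in>set r'. z \<le> x"
    | a b y c' where "T = hook_tableau (a @ y # b) c'" "r = a @ x # b" "c = y # c'" "x < y"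
        "\<forall>z\<in>set a. z \<le> x" "c' \<noteq> [] \<longrightarrow> y < hd c'"
proof (cases T)
  case Nil
  with assms that(1) show ?thesis by (simp add: hook_tableau_def)
next
  case (Cons r1 T1)
  obtain r' b where r': "row_insert x r1 = (r', b)" by fastforce
  show ?thesis
  proof (cases b)
    case None
    with r' Cons assms(1) have "r = r1 @ [x]" "T = hook_tableau r1 c"
      by (auto simp: hook_tableau_def dest: row_insert_NoneD)
    moreover have "\<forall>z\<in>set r1. z \<le> x" using row_insert_None_iff[of x r1] r' None by simp
    moreover have "r1 \<noteq> []" using assms(2) Cons by auto
    ultimately show ?thesis using that(2)[of r1] by blast
  next
    case (Some y)
    with r' Cons assms(1) have r: "r' = r" "tableau_insert y T1 = map (\<lambda>x. [x]) c"
      by (auto simp: hook_tableau_def)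
    with tableau_insert_eq_columnD[OF r(2)] assms(2) Cons obtain c' where
      c': "T1 = map (\<lambda>x. [x]) c'" "c = y # c'" "c' \<noteq> [] \<longrightarrow> y < hd c'" by auto
    from row_insert_SomeD[of x r1 r' y] r' Some obtain a b where
      "x < y" "r1 = a @ y # b" "r' = a @ x # b" "\<forall>z\<in>set a. z \<le> x" by blast
    with that(3)[of a y b c'] Cons c' r(1) show ?thesis by (simp add: hook_tableau_def)
  qed
qed

text \<open>A bumped letter \<open>y\<close> arrives on top of the leg, is smaller than the previous
  top, and exceeds the letter \<open>x\<close> that bumped it, which is at least the corner.\<close>

lemma insertion_tableau_eq_hook_tableauD:
  "insertion_tableau w = hook_tableau r c \<Longrightarrow> sorted_wrt (<) c \<and> (c \<noteq> [] \<longrightarrow> hd r < hd c)"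
proof (induction w arbitrary: r c rule: rev_induct)
  case Nil
  then show ?case by (simp add: hook_tableau_def)
next
  case (snoc x w)
  then have "tableau_insert x (insertion_tableau w) = hook_tableau r c"
    by (simp add: insertion_tableau_snoc)
  from this insertion_tableau_rows_nonempty show ?case
  proof (cases rule: tableau_insert_eq_hook_tableauD)
    case 1
    then show ?thesis by simp
  next
    case (2 r')
    then show ?thesis using snoc.IH[of r' c] by simp
  next
    case (3 a b y c')
    then have "sorted_wrt (<) c'" using snoc.IH by blast
    with 3 have "sorted_wrt (<) c" by (cases c') (auto intro: less_trans)
    moreover have "hd r \<le> x" using 3 by (cases a) auto
    ultimately show ?thesis using 3 by simp
  qed
qed

section \<open>Words with a prescribed hook as insertion tableau\<close>

definition hook_words :: "'a::linorder list \<Rightarrow> 'a list \<Rightarrow> 'a list set" where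
  "hook_words r c = {w. insertion_tableau w = hook_tableau r c}"

lemma mset_hook_words:
  assumes "w \<in> hook_words r c"
  shows "mset w = mset (r @ c)"
proof -
  have "mset w = mset (concat (rev (insertion_tableau w)))" by (rule mset_insertion_tableau[symmetric])
  also have "insertion_tableau w = hook_tableau r c" using assms by (simp add: hook_words_def)
  finally show ?thesis by (simp only: mset_hook_tableau)
qed

lemma finite_hook_words: "finite (hook_words r c)"
proof (rule finite_subset)
  show "hook_words r c \<subseteq> permutations_of_multiset (mset (r @ c))"
    by (intro subsetI permutations_of_multisetI mset_hook_words)
qed simp

lemma hook_words_Nil [simp]: "hook_words [] c = {}"
proof -
  have "[] \<in> set (insertion_tableau w)" if "w \<in> hook_words [] c" for w
    using that by (simp add: hook_words_def hook_tableau_def)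
  then show ?thesis using insertion_tableau_rows_nonempty by blast
qed

lemma hook_words_singleton: "hook_words [x] [] = {[x]}"
proof -
  have "w = [x]" if "w \<in> hook_words [x] []" for w using mset_hook_words[OF that] by simp
  moreover have "[x] \<in> hook_words [x] []"
    by (simp add: hook_words_def hook_tableau_def insertion_tableau_def)
  ultimately show ?thesis by blast
qed

lemma butlast_append_last_in_hook_words:
  assumes "sorted_wrt (<) r" "r \<noteq> []" "w \<in> hook_words (butlast r) c"
  shows "w @ [last r] \<in> hook_words r c"
proof -
  obtain r' x where r: "r = r' @ [x]" using assms(2) by (cases r rule: rev_cases) auto
  with assms(1) have "\<forall>z\<in>set r'. z \<le> x" by (auto simp: sorted_wrt_append)
  then show ?thesis using assms(3) r
    by (simp add: hook_words_def insertion_tableau_snoc hook_tableau_def row_insert_append)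
qed

text \<open>The last letter was either appended, and is then the end of \<open>r\<close>, or it
  bumped the top \<open>y\<close> of the leg. In the latter case it must be \<open>x\<close>, the
  largest entry of \<open>r\<close> below \<open>y\<close>.\<close>

lemma hook_words_Cons:
  assumes r: "r = a @ x # b" "sorted_wrt (<) r" and c: "sorted_wrt (<) (y # c)"
    and y: "x < y" "\<forall>z\<in>set b. y < z"
  shows "hook_words r (y # c) =
    (\<lambda>w. w @ [last r]) ` hook_words (butlast r) (y # c) \<union>
    (\<lambda>w. w @ [x]) ` hook_words (a @ y # b) c" (is "_ = ?A \<union> ?B")
proof (intro equalityI subsetI)
  fix w assume w: "w \<in> hook_words r (y # c)"
  have "w \<noteq> []" using w by (auto simp: hook_words_def hook_tableau_def)
  then obtain w' z where w': "w = w' @ [z]" by (cases w rule: rev_cases) auto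
  with w have "tableau_insert z (insertion_tableau w') = hook_tableau r (y # c)"
    by (simp add: hook_words_def insertion_tableau_snoc)
  from this insertion_tableau_rows_nonempty show "w \<in> ?A \<union> ?B"
  proof (cases rule: tableau_insert_eq_hook_tableauD)
    case (2 r')
    then show ?thesis using w' by (auto simp: hook_words_def)
  next
    case (3 a' b' y' c')
    have ylt: "y < t" if "t \<in> set b'" for t
    proof -
      have "sorted (a' @ y # b')"
        using sorted_insertion_tableau[of "a' @ y # b'" w'] 3 by (simp add: hook_tableau_def)
      then have "y \<le> t" using that by (simp add: sorted_append)
      moreover have "t \<in> set r" using 3 that by simp
      then have "t \<noteq> y" using r(1,2) y by (auto simp: sorted_wrt_append)
      ultimately show ?thesis by simp
    qed
    have "\<not> y < t" if "t \<in> set a'" for t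
      using that 3 by force
    \<comment> \<open>Both decompositions of \<open>r\<close> have the entries above
      \<open>y\<close> as their right part, so they coincide.\<close>
    then have "filter (\<lambda>t. y < t) r = b'" using 3 ylt
      by (auto simp: filter_empty_conv intro!: filter_True)
    moreover have "filter (\<lambda>t. y < t) r = b"
      using r y by (force simp: sorted_wrt_append filter_empty_conv intro!: filter_True)
    ultimately have "b' = b" by simp
    with 3 r have "a' = a" "z = x" by auto
    with 3 \<open>b' = b\<close> w' show ?thesis by (auto simp: hook_words_def)
  qed simp
next
  fix w assume "w \<in> ?A \<union> ?B"
  then consider v where "v \<in> hook_words (butlast r) (y # c)" "w = v @ [last r]"
    | v where "v \<in> hook_words (a @ y # b) c" "w = v @ [x]" by blast
  then show "w \<in> hook_words r (y # c)"
  proof cases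
    case 1
    then show ?thesis using butlast_append_last_in_hook_words[OF r(2)] r(1) by simp
  next
    case 2
    have "\<forall>z\<in>set a. z \<le> x" using r by (auto simp: sorted_wrt_append)
    with 2 y(1) r(1) tableau_insert_column[OF c] show ?thesis
      by (simp add: hook_words_def insertion_tableau_snoc hook_tableau_def row_insert_bump)
  qed
qed

lemma hook_words_row:
  assumes "sorted_wrt (<) r" "2 \<le> length r"
  shows "hook_words r [] = (\<lambda>w. w @ [last r]) ` hook_words (butlast r) []" (is "_ = ?A")
proof (intro equalityI subsetI)
  fix w assume w: "w \<in> hook_words r []"
  have "w \<noteq> []" using w by (auto simp: hook_words_def hook_tableau_def)
  then obtain w' z where w': "w = w' @ [z]" by (cases w rule: rev_cases) auto
  with w have "tableau_insert z (insertion_tableau w') = hook_tableau r []"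
    by (simp add: hook_words_def insertion_tableau_snoc)
  from this insertion_tableau_rows_nonempty show "w \<in> ?A"
  proof (cases rule: tableau_insert_eq_hook_tableauD)
    case 1
    with assms(2) show ?thesis by simp
  next
    case (2 r')
    then show ?thesis using w' by (auto simp: hook_words_def)
  qed simp
next
  fix w assume "w \<in> ?A"
  moreover have "r \<noteq> []" using assms(2) by auto
  ultimately show "w \<in> hook_words r []" using butlast_append_last_in_hook_words[OF assms(1)] by blast
qed

text \<open>Undoing the last insertion gives Pascal's rule: one term keeps the leg and shortens the
  row, the other shortens the leg and keeps the length of the row.\<close>

lemma card_hook_words:
  assumes "sorted_wrt (<) r" "r \<noteq> []" "sorted_wrt (<) c" "c \<noteq> [] \<longrightarrow> hd r < hd c" "distinct (r @ c)"
  shows "card (hook_words r c) = (length r + length c - 1) choose length c"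
  using assms
proof (induction "length r + length c" arbitrary: r c)
  case 0
  then show ?case by simp
next
  case (Suc n)
  have snoc_card: "card ((\<lambda>w. w @ [z]) ` X) = card X" for z and X :: "'a list set"
    by (intro card_image inj_onI) auto
  obtain r' l where r: "r = r' @ [l]" using Suc.prems(2) by (cases r rule: rev_cases) auto
  have shorter: "card (hook_words r' c) = (length r' + length c - 1) choose length c" if "r' \<noteq> []"
    using Suc.hyps(2) Suc.prems r that by (intro Suc.hyps(1)) (auto simp: sorted_wrt_append)
  show ?case
  proof (cases c)
    case Nil
    show ?thesis
    proof (cases "r' = []")
      case True
      with Nil r show ?thesis by (simp add: hook_words_singleton)
    next
      case False
      with r have "2 \<le> length r" by (cases r') auto
      with hook_words_row[OF Suc.prems(1)] r Nil snoc_card shorter[OF False] show ?thesis by simp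
    qed
  next
    case (Cons y c')
    \<comment> \<open>The row is cut at \<open>y\<close>: \<open>x\<close> is its largest letter
      below \<open>y\<close>, which exists because \<open>hd r\<close> < \<open>y\<close>.\<close>
    define a x b where "a = butlast (takeWhile (\<lambda>z. z < y) r)" "x = last (takeWhile (\<lambda>z. z < y) r)"
      "b = dropWhile (\<lambda>z. z < y) r"
    have "takeWhile (\<lambda>z. z < y) r \<noteq> []" using Suc.prems(2,4) Cons by (cases r) auto
    then have tw: "takeWhile (\<lambda>z. z < y) r = a @ [x]" by (simp add: a_x_b_def)
    then have axb: "r = a @ x # b"
      using takeWhile_dropWhile_id[of "\<lambda>z. z < y" r] unfolding a_x_b_def(3) by simp
    have "x \<in> set (takeWhile (\<lambda>z. z < y) r)" by (simp add: tw)
    then have "x < y" by (rule set_takeWhileD[THEN conjunct2])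
    have yb: "y < z" if "z \<in> set b" for z
    proof -
      have "y \<le> hd b" using hd_dropWhile[of "\<lambda>z. z < y" r] that unfolding a_x_b_def by fastforce
      moreover have "sorted b" using Suc.prems(1) axb by (auto simp: strict_sorted_iff sorted_append)
      then have "hd b \<le> z" using that by (cases b) auto
      moreover have "z \<noteq> y" using Suc.prems(5) axb Cons that by auto
      ultimately show ?thesis by simp
    qed
    have IH: "card (hook_words (a @ y # b) c') = (length (a @ y # b) + length c' - 1) choose length c'"
    proof (rule Suc.hyps(1))
      show "n = length (a @ y # b) + length c'" using Suc.hyps(2) axb Cons by simp
      show "sorted_wrt (<) (a @ y # b)"
        using Suc.prems(1) axb yb \<open>x < y\<close> by (force simp: sorted_wrt_append)
      show "sorted_wrt (<) c'" using Suc.prems(3) Cons by simp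
      have "hd (a @ y # b) \<le> y" using Suc.prems(1) axb \<open>x < y\<close> by (cases a) (auto simp: sorted_wrt_append)
      then show "c' \<noteq> [] \<longrightarrow> hd (a @ y # b) < hd c'"
        using Suc.prems(3) Cons by (cases c') auto
      show "distinct ((a @ y # b) @ c')" using Suc.prems(5) axb Cons by auto
    qed simp
    have "hook_words r c = (\<lambda>w. w @ [l]) ` hook_words r' c \<union> (\<lambda>w. w @ [x]) ` hook_words (a @ y # b) c'"
      using hook_words_Cons[OF axb Suc.prems(1) _ \<open>x < y\<close>, of c'] Suc.prems(3) Cons yb r by simp
    \<comment> \<open>A common word would, without its last letter, have a tableau with both legs
      \<open>c\<close> and \<open>c'\<close>, which differ in length.\<close>
    moreover have "(\<lambda>w. w @ [l]) ` hook_words r' c \<inter> (\<lambda>w. w @ [x]) ` hook_words (a @ y # b) c' = {}"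
      using Cons by (auto simp: hook_words_def)
    ultimately have "card (hook_words r c) = card (hook_words r' c) + card (hook_words (a @ y # b) c')"
      by (simp add: card_Un_disjoint finite_hook_words snoc_card)
    moreover have "length (a @ y # b) + length c' - 1 = length r' + length c'"
      using arg_cong[OF axb, of length] r by simp
    ultimately have "card (hook_words r c) =
        card (hook_words r' c) + ((length r' + length c') choose length c')"
      using IH by simp
    \<comment> \<open>If \<open>r'\<close> is empty, both sides are 0, since \<open>length c\<close>
      exceeds \<open>length c'\<close> by one.\<close>
    moreover have "card (hook_words r' c) = (length r' + length c') choose length c"
      using shorter Cons by (cases "r' = []") auto
    ultimately show ?thesis using r Cons by (simp add: add.commute)
  qed
qed

section \<open>Summation over the legs\<close>

text \<open>With 1 in the corner and 2 in the first row, the leg is a subset of {3..n}; the leg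
  determines the hook.\<close>

lemma hook_class_eq_UN:
  fixes n :: nat
  assumes "2 \<le> n"
  shows "{w \<in> permutations_of_set {1..n}.
      hook_shaped (insertion_tableau w) \<and> 2 \<in> set (hd (insertion_tableau w))} =
    (\<Union>S\<in>Pow {3..n}. hook_words (sorted_list_of_set ({1..n} - S)) (sorted_list_of_set S))"
    (is "?H = ?U")
proof (intro equalityI subsetI)
  fix w assume w: "w \<in> ?H"
  then have perm: "set w = {1..n}" "distinct w" by (auto simp: permutations_of_set_def)
  from w obtain r c where r: "r \<noteq> []" "insertion_tableau w = hook_tableau r c"
    unfolding hook_shaped_altdef hook_tableau_def by blast
  have m: "mset w = mset (r @ c)" using mset_hook_words[of w r c] r by (simp add: hook_words_def)
  then have "set (r @ c) = {1..n}" using perm mset_eq_setD by metis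
  moreover have "distinct (r @ c)" using m perm mset_eq_imp_distinct_iff by metis
  ultimately have rc: "set r = {1..n} - set c" "set c \<subseteq> {1..n}" "distinct r" "distinct c" by auto
  have c: "sorted_wrt (<) c" "c \<noteq> [] \<longrightarrow> hd r < hd c"
    using insertion_tableau_eq_hook_tableauD[OF r(2)] by auto
  have "sorted r" using sorted_insertion_tableau[of r w] r by (simp add: hook_tableau_def)
  then have "sorted_list_of_set (set r) = r"
    using rc(3) by (intro sorted_list_of_set.idem_if_sorted_distinct) auto
  then have "sorted_list_of_set ({1..n} - set c) = r" unfolding rc(1) .
  moreover have "sorted_list_of_set (set c) = c"
    using c(1) by (intro sorted_list_of_set.idem_if_sorted_distinct) (auto simp: strict_sorted_iff)
  moreover have "3 \<le> z" if "z \<in> set c" for z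
  proof -
    have "c \<noteq> []" using that by auto
    then have "hd c \<le> z" using c(1) that by (cases c) auto
    moreover have "hd r \<in> {1..n}" using rc(1) r(1) hd_in_set by blast
    ultimately have "1 < z" using c(2) \<open>c \<noteq> []\<close> by auto
    moreover have "z \<noteq> 2" using w r that rc(1) by (auto simp: hook_tableau_def)
    ultimately show ?thesis by simp
  qed
  with rc(2) have "set c \<in> Pow {3..n}" by auto
  moreover have "w \<in> hook_words r c" using r by (simp add: hook_words_def)
  ultimately show "w \<in> ?U" by (intro UN_I[of "set c"]) auto
next
  fix w assume "w \<in> ?U"
  then obtain S where S: "S \<subseteq> {3..n}"
    and w: "w \<in> hook_words (sorted_list_of_set ({1..n} - S)) (sorted_list_of_set S)" by blast
  have fin: "finite S" using S finite_subset by blast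
  have "S \<subseteq> {1..n}" using S by auto
  with fin mset_eq_setD[OF mset_hook_words[OF w]] mset_eq_imp_distinct_iff[OF mset_hook_words[OF w]]
  have m: "set w = {1..n}" "distinct w" by auto
  have two: "2 \<in> {1..n} - S" using S assms by auto
  then have "sorted_list_of_set ({1..n} - S) \<noteq> []" by (metis empty_iff finite_Diff finite_atLeastAtMost
        sorted_list_of_set_eq_Nil_iff)
  moreover have T: "insertion_tableau w =
      sorted_list_of_set ({1..n} - S) # map (\<lambda>x. [x]) (sorted_list_of_set S)"
    using w by (simp add: hook_words_def hook_tableau_def)
  ultimately have "hook_shaped (insertion_tableau w)" unfolding hook_shaped_altdef by blast
  moreover have "2 \<in> set (hd (insertion_tableau w))" using T two by simp
  ultimately show "w \<in> ?H" using m by (simp add: permutations_of_set_def)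
qed

lemma sum_Pow_card:
  fixes f :: "nat \<Rightarrow> nat"
  assumes "finite A"
  shows "(\<Sum>S\<in>Pow A. f (card S)) = (\<Sum>k\<le>card A. (card A choose k) * f k)"
proof -
  have "(\<Sum>S\<in>Pow A. f (card S)) = (\<Sum>k\<le>card A. \<Sum>S\<in>{S \<in> Pow A. card S = k}. f (card S))"
    using assms by (intro sum.group[symmetric]) (auto intro: card_mono)
  also have "\<dots> = (\<Sum>k\<le>card A. (card A choose k) * f k)"
    using n_subsets[OF assms] by (intro sum.cong) auto
  finally show ?thesis .
qed

lemma card_hook_class:
  assumes "2 \<le> n"
  shows "card {w \<in> permutations_of_set {1..n}.
      hook_shaped (insertion_tableau w) \<and> 2 \<in> set (hd (insertion_tableau w))} =
    (2 * n - 3) choose (n - 1)"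
proof -
  let ?W = "\<lambda>S. hook_words (sorted_list_of_set ({1..n} - S)) (sorted_list_of_set S)"
  have cardW: "card (?W S) = (n - 1) choose card S" if S: "S \<subseteq> {3..n}" for S
  proof -
    have fin: "finite S" using S finite_subset by blast
    let ?A = "{1..n} - S"
    have "1 \<in> ?A" using S assms by auto
    then have A: "Min ?A \<le> 1" "?A \<noteq> {}" by (auto intro!: Min_le)
    have "hd (sorted_list_of_set ?A) < hd (sorted_list_of_set S)" if "S \<noteq> {}"
    proof -
      have "3 \<le> Min S" using S fin that by (auto intro!: Min.boundedI)
      with A(1) have "Min ?A < Min S" by linarith
      with A(2) fin that show ?thesis by (simp add: sorted_list_of_set_nonempty del: Min_less_iff Min_gr_iff)
    qed
    then have "card (?W S) = (card ?A + card S - 1) choose card S"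
      using A fin card_hook_words[of "sorted_list_of_set ?A" "sorted_list_of_set S"] by auto
    moreover have "S \<subseteq> {1..n}" using S by auto
    then have "card ?A + card S = n"
      using fin card_mono[of "{1..n}" S] by (simp add: card_Diff_subset)
    ultimately show ?thesis by simp
  qed
  have "card (\<Union>S\<in>Pow {3..n}. ?W S) = (\<Sum>S\<in>Pow {3..n}. card (?W S))"
  proof (intro card_UN_disjoint ballI impI)
    fix S S' assume "S \<in> Pow {3..n}" "S' \<in> Pow {3..n}" "S \<noteq> S'"
    then have "sorted_list_of_set S \<noteq> sorted_list_of_set S'"
      using finite_subset[of S "{3..n}"] finite_subset[of S' "{3..n}"] by (auto dest: sorted_list_of_set_inject)
    then show "?W S \<inter> ?W S' = {}" by (auto simp: hook_words_def)
  qed (auto simp: finite_hook_words)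
  also have "\<dots> = (\<Sum>S\<in>Pow {3..n}. (n - 1) choose card S)" using cardW by (intro sum.cong) auto
  also have "\<dots> = (\<Sum>k\<le>n - 2. (n - 2 choose k) * (n - 1 choose k))"
    using sum_Pow_card[of "{3..n}" "\<lambda>k. n - 1 choose k"] by simp
  \<comment> \<open>The added term for k = n-1 is 0; the longer range and the reflected second
    factor are the shape of Vandermonde's identity.\<close>
  also have "\<dots> = (\<Sum>k\<le>n - 1. (n - 2 choose k) * (n - 1 choose k))"
    by (intro sum.mono_neutral_left) (auto simp: binomial_eq_0)
  also have "\<dots> = (\<Sum>k\<le>n - 1. (n - 2 choose k) * (n - 1 choose (n - 1 - k)))"
    using binomial_symmetric[of _ "n - 1"] by (intro sum.cong refl) (metis atMost_iff)
  also have "\<dots> = (n - 2 + (n - 1)) choose (n - 1)" by (rule vandermonde)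
  also have "n - 2 + (n - 1) = 2 * n - 3" using assms by simp
  finally show ?thesis unfolding hook_class_eq_UN[OF assms] .
qed

section \<open>Sizes of the avoidance classes and comparison with cycles\<close>

lemma card_class_avoiders:
  assumes "2 \<le> n"
  shows "card (class_avoiders knuth_equiv pattern_231_min n) = ((2 * n - 3) choose (n - 1)) + 1"
proof -
  let ?H = "{w \<in> permutations_of_set {1..n}.
      hook_shaped (insertion_tableau w) \<and> 2 \<in> set (hd (insertion_tableau w))}"
  let ?p = "rev [1..<n + 1]"
  have "?p \<notin> ?H"
  proof
    assume "?p \<in> ?H"
    then obtain r rs where T: "insertion_tableau ?p = r # rs" "r \<noteq> []" "2 \<in> set r"
      unfolding hook_shaped_altdef by auto
    \<comment> \<open>The decreasing word is its own reading word. So its first row is decreasing as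
      well as increasing, and containing 2 it would be [2], although the word ends in 1.\<close>
    have eq: "concat (rev rs) @ r = ?p"
      using knuth_equiv_decreasing[OF knuth_equiv_reading_word[of ?p] sorted_wrt_rev_upt] T(1) by simp
    then have "sorted_wrt (>) r" using sorted_wrt_rev_upt[of 1 "n + 1"] by (metis sorted_wrt_append)
    moreover have "sorted r" using sorted_insertion_tableau[of r ?p] T by simp
    ultimately have "r = [2]" using T(2,3) by (cases r; cases "tl r") auto
    with eq rev_upt_conv_snoc[of n] assms show False by (metis last_snoc One_nat_def Suc_1 Suc_leD n_not_Suc_n)
  qed
  then show ?thesis
    using class_avoiders_eq[of n] card_hook_class[OF assms] assms by (simp del: upt_Suc)
qed

text \<open>For n = 1 the letter 2 does not exist, so only the reverse identity remains.\<close>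

lemma card_class_avoiders_1: "card (class_avoiders knuth_equiv pattern_231_min 1) = 1"
proof -
  have "2 \<notin> set (hd (insertion_tableau w))" if "w \<in> permutations_of_set {1..1}" for w :: "nat list"
    using that insertion_tableau_first_row[of w] set_insertion_tableau[of w]
    by (force simp: permutations_of_set_def)
  then show ?thesis unfolding class_avoiders_eq[OF order_refl] by (subst Collect_empty_eq[THEN iffD2]) auto
qed

theorem proposition5p13:
  shows "(\<forall>n\<ge>1. class_avoiders knuth_equiv pattern_231_min n =
           {\<pi> \<in> permutations_of_set {1..n}.
              hook_shaped (insertion_tableau \<pi>) \<and> 2 \<in> set (hd (insertion_tableau \<pi>))}
           \<union> {rev [1..<n + 1]}) \<and>
         map (\<lambda>n. card (class_avoiders knuth_equiv pattern_231_min n)) [1..<10] =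
           [1, 2, 4, 11, 36, 127, 463, 1717, 6436] \<and>
         (\<forall>n\<ge>3. card (class_avoiders knuth_equiv pattern_231_min n) =
           card (graph_congruences (cycle_graph (2 * (n - 1)))))"
proof (intro conjI allI impI)
  show "map (\<lambda>n. card (class_avoiders knuth_equiv pattern_231_min n)) [1..<10] =
      [1, 2, 4, 11, 36, 127, 463, 1717, 6436]"
  proof -
    have "[1..<10] = [1, 2, 3, 4, 5, 6, 7, 8, 9 :: nat]"
      by (simp add: upt_conv_Cons)
    \<comment> \<open>The binomials (2n-3 choose n-1) for n = 3, ..., 9.\<close>
    moreover have "3 choose 2 = (3 :: nat)" "5 choose 3 = (10 :: nat)" "7 choose 4 = (35 :: nat)"
      "9 choose 5 = (126 :: nat)" "11 choose 6 = (462 :: nat)" "13 choose 7 = (1716 :: nat)"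
      "15 choose 8 = (6435 :: nat)"
      by (simp_all add: binomial_fact' fact_numeral)
    ultimately show ?thesis
      using card_class_avoiders_1 by (simp add: card_class_avoiders)
  qed
next
  \<comment> \<open>The cycle has 2m vertices with m = n-1; the two binomials have top 2m-1 and
    complementary lower entries m and m-1.\<close>
  fix n :: nat assume n: "3 \<le> n"
  then have "2 * n - 3 = 2 * (n - 1) - 1" by simp
  moreover have "2 * (n - 1) - 1 - (n - 1) = n - 1 - 1" using n by linarith
  then have "2 * (n - 1) - 1 choose (n - 1) = (2 * (n - 1) - 1 choose (n - 1 - 1))"
    using n binomial_symmetric[of "n - 1" "2 * (n - 1) - 1"] by simp
  ultimately show "card (class_avoiders knuth_equiv pattern_231_min n) =
      card (graph_congruences (cycle_graph (2 * (n - 1))))"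
    using n le_diff_conv2[of 1 n 2] card_class_avoiders[of n] card_graph_congruences_even_cycle[of "n - 1"] by simp
qed (rule class_avoiders_eq)

end
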